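(* Let $\mathcal{N}=\mathbb{R}\times\mathbb{C}^n$ be the Heisenberg group with its standard Sasaki metric $g_0$, and let $\pi\le\mathcal{N}\rtimes\langle\tau\rangle\le\mathrm{Isom}(\mathcal{N},g_0)$ be the torsion-free discrete group generated by the lattice $\Lambda=\mathbb{Z}\times(\mathbb{Z}^n+i\mathbb{Z}^n)\subseteq\mathcal{N}$ and the element $\mu=\alpha_{1/2}\,\tau$, where $\alpha_{1/2}=(0,(\tfrac12,0,\ldots,0))\in\mathcal{N}$ and $\tau(t,z)=(-t,\bar z)$. Let $\hat g_0$ be the Riemannian metric on the compact infra-nilmanifold $\pi\backslash\mathcal{N}$ induced by $g_0$. Then $(\pi\backslash \mathcal{N},\hat g_0)$ does not admit any compatible Sasaki structure.
   Context: Group law on $\mathcal{N}$: $(t,z)(s,w)=(t+s-\mathrm{Im}({}^t\bar z w),z+w)$. The standard left-invariant pseudo-Hermitian structure on $\mathcal{N}$ is $\{\omega_0,J\}$ with $\omega_0=dt+\mathrm{Im}({}^t\bar z\,dz)$ and $J$ the complex structure on $\ker\omega_0$ corresponding to the standard complex structure of $\mathbb{C}^n$ under the projection $\mathcal{N}\to\mathbb{C}^n$; $g_0=\omega_0\cdot\omega_0+d\omega_0\circ J$, where $d\omega_0\circ J$ denotes $(X,Y)\mapsto d\omega_0(X,JY)$ on $\ker\omega_0$. The map $\tau$ is an automorphism of $\mathcal{N}$ of order two which is an isometry of $g_0$, and $\mathcal{N}$ acts on itself by left multiplication. A pseudo-Hermitian structure on a manifold $M$ is a pair $\{\eta,J'\}$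 with $\eta$ a contact form and $J'$ an (integrable, CR) complex structure on $\ker\eta$ such that $d\eta\circ J'$ is positive definite Hermitian on $\ker\eta$; it is standard if the flow of the Reeb field $\mathcal{A}$ (given by $\eta(\mathcal{A})=1$, $\iota_{\mathcal{A}}d\eta=0$) preserves $J'$. A Sasaki structure compatible with a Riemannian metric $g$ on $M$ is a standard pseudo-Hermitian structure $\{\eta,J'\}$ on $M$ with $g=\eta\cdot\eta+d\eta\circ J'$. *)

theory Defs
  imports
    "HOL-Analysis.Analysis"
    "HOL-Algebra.Bij"
    "HOL-Algebra.Generated_Groups"
    "HOL-Combinatorics.Permutations"
begin

section \<open>Calculus on open subsets of a Euclidean space\<close>

text \<open>All notions of this section are meant for open sets \<open>S\<close>. Tangent vectors of \<open>'e\<close> are elements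
  of \<open>'e\<close>; a 1-form is a function \<open>\<alpha>\<close> of a point and a tangent vector.\<close>

primrec Ck_on :: "nat \<Rightarrow> 'a::real_normed_vector set \<Rightarrow> ('a \<Rightarrow> 'b::real_normed_vector) \<Rightarrow> bool" where
  "Ck_on 0 S f \<longleftrightarrow> continuous_on S f"
| "Ck_on (Suc k) S f \<longleftrightarrow>
     (\<forall>x\<in>S. f differentiable (at x)) \<and> (\<forall>v. Ck_on k S (\<lambda>x. frechet_derivative f (at x) v))"

definition smooth_on :: "'a::real_normed_vector set \<Rightarrow> ('a \<Rightarrow> 'b::real_normed_vector) \<Rightarrow> bool" where
  "smooth_on S f \<longleftrightarrow> (\<forall>k. Ck_on k S f)"

definition one_form_on :: "'e::euclidean_space set \<Rightarrow> ('e \<Rightarrow> 'e \<Rightarrow> real) \<Rightarrow> bool" where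
  "one_form_on S \<alpha> \<longleftrightarrow> (\<forall>x\<in>S. linear (\<alpha> x)) \<and> (\<forall>v. smooth_on S (\<lambda>x. \<alpha> x v))"

text \<open>The exterior derivative without the factor 1/2,
  \<open>d\<alpha>(X,Y) = X(\<alpha>(Y)) - Y(\<alpha>(X)) - \<alpha>([X,Y])\<close>, evaluated on constant (hence commuting) fields;
  so \<open>d(x dy) = dx \<and> dy\<close> takes the value 1 on the two coordinate fields.\<close>

definition ext_deriv :: "('e::euclidean_space \<Rightarrow> 'e \<Rightarrow> real) \<Rightarrow> 'e \<Rightarrow> 'e \<Rightarrow> 'e \<Rightarrow> real" where
  "ext_deriv \<alpha> x v w =
     frechet_derivative (\<lambda>y. \<alpha> y w) (at x) v - frechet_derivative (\<lambda>y. \<alpha> y v) (at x) w"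

definition lie_bracket :: "('e::euclidean_space \<Rightarrow> 'e) \<Rightarrow> ('e \<Rightarrow> 'e) \<Rightarrow> 'e \<Rightarrow> 'e" where
  "lie_bracket X Y x =
     frechet_derivative Y (at x) (X x) - frechet_derivative X (at x) (Y x)"

text \<open>A positive multiple (depending on \<open>n\<close> and the normalisation of \<open>\<and>\<close>) of the value of
  \<open>\<beta> \<and> \<Omega>\<^sup>n\<close> on the vectors \<open>v 0, \<dots>, v (2n)\<close>, for a linear form \<open>\<beta>\<close> and a 2-form \<open>\<Omega>\<close>.\<close>

definition wedge_top :: "nat \<Rightarrow> ('e \<Rightarrow> real) \<Rightarrow> ('e \<Rightarrow> 'e \<Rightarrow> real) \<Rightarrow> (nat \<Rightarrow> 'e) \<Rightarrow> real" where
  "wedge_top n \<beta> \<Omega> v =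
     (\<Sum>\<sigma> | \<sigma> permutes {..2 * n}.
        of_int (sign \<sigma>) * \<beta> (v (\<sigma> 0)) * (\<Prod>i<n. \<Omega> (v (\<sigma> (2 * i + 1))) (v (\<sigma> (2 * i + 2)))))"

definition contact_on :: "'e::euclidean_space set \<Rightarrow> ('e \<Rightarrow> 'e \<Rightarrow> real) \<Rightarrow> bool" where
  "contact_on S \<alpha> \<longleftrightarrow> one_form_on S \<alpha> \<and>
     (\<exists>n. DIM('e) = 2 * n + 1 \<and> (\<forall>x\<in>S. \<exists>v. wedge_top n (\<alpha> x) (ext_deriv \<alpha> x) v \<noteq> 0))"

text \<open>Smooth local sections of \<open>ker \<alpha>\<close>.\<close>

definition kernel_field_on :: "'e::euclidean_space set \<Rightarrow> ('e \<Rightarrow> 'e \<Rightarrow> real) \<Rightarrow> ('e \<Rightarrow> 'e) \<Rightarrow> bool" where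
  "kernel_field_on V \<alpha> X \<longleftrightarrow> smooth_on V X \<and> (\<forall>x\<in>V. \<alpha> x (X x) = 0)"

text \<open>An almost complex structure \<open>J\<close> on the bundle \<open>ker \<alpha>\<close>. The values of \<open>J x\<close> outside \<open>ker (\<alpha> x)\<close>
  are irrelevant, here and below.\<close>

definition complex_structure_on ::
    "'e::euclidean_space set \<Rightarrow> ('e \<Rightarrow> 'e \<Rightarrow> real) \<Rightarrow> ('e \<Rightarrow> 'e \<Rightarrow> 'e) \<Rightarrow> bool" where
  "complex_structure_on S \<alpha> J \<longleftrightarrow>
     (\<forall>x\<in>S. \<forall>v w r. \<alpha> x v = 0 \<longrightarrow> \<alpha> x w = 0 \<longrightarrow>
        \<alpha> x (J x v) = 0 \<and> J x (J x v) = - v \<and>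
        J x (v + w) = J x v + J x w \<and> J x (r *\<^sub>R v) = r *\<^sub>R J x v) \<and>
     (\<forall>V X. open V \<longrightarrow> V \<subseteq> S \<longrightarrow> kernel_field_on V \<alpha> X \<longrightarrow> smooth_on V (\<lambda>x. J x (X x)))"

text \<open>Integrability: the bundle of vectors \<open>X - \<i> JX\<close> (\<open>X\<close> in \<open>ker \<alpha>\<close>) is closed under brackets.
  Indeed \<open>[X - \<i> JX, Y - \<i> JY] = Z - \<i> W\<close> with
  \<open>Z = [X,Y] - [JX,JY]\<close> and \<open>W = [X,JY] + [JX,Y]\<close>, so the condition reads: \<open>Z\<close> is in \<open>ker \<alpha>\<close>, \<open>W = JZ\<close>.\<close>

definition cr_integrable_on ::
    "'e::euclidean_space set \<Rightarrow> ('e \<Rightarrow> 'e \<Rightarrow> real) \<Rightarrow> ('e \<Rightarrow> 'e \<Rightarrow> 'e) \<Rightarrow> bool" where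
  "cr_integrable_on S \<alpha> J \<longleftrightarrow>
     (\<forall>V X Y. open V \<longrightarrow> V \<subseteq> S \<longrightarrow> kernel_field_on V \<alpha> X \<longrightarrow> kernel_field_on V \<alpha> Y \<longrightarrow>
        (\<forall>x\<in>V.
          let JX = (\<lambda>y. J y (X y)); JY = (\<lambda>y. J y (Y y));
              Z = lie_bracket X Y x - lie_bracket JX JY x;
              W = lie_bracket X JY x + lie_bracket JX Y x
          in \<alpha> x Z = 0 \<and> W = J x Z))"

definition pos_def_hermitian_on ::
    "'e::euclidean_space set \<Rightarrow> ('e \<Rightarrow> 'e \<Rightarrow> real) \<Rightarrow> ('e \<Rightarrow> 'e \<Rightarrow> 'e) \<Rightarrow> bool" where
  "pos_def_hermitian_on S \<alpha> J \<longleftrightarrow>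
     (\<forall>x\<in>S. let h = (\<lambda>v w. ext_deriv \<alpha> x v (J x w)) in
        (\<forall>v w. \<alpha> x v = 0 \<longrightarrow> \<alpha> x w = 0 \<longrightarrow> h v w = h w v \<and> h (J x v) (J x w) = h v w) \<and>
        (\<forall>v. \<alpha> x v = 0 \<longrightarrow> v \<noteq> 0 \<longrightarrow> h v v > 0))"

definition pseudo_hermitian_on ::
    "'e::euclidean_space set \<Rightarrow> ('e \<Rightarrow> 'e \<Rightarrow> real) \<Rightarrow> ('e \<Rightarrow> 'e \<Rightarrow> 'e) \<Rightarrow> bool" where
  "pseudo_hermitian_on S \<alpha> J \<longleftrightarrow>
     contact_on S \<alpha> \<and> complex_structure_on S \<alpha> J \<and> cr_integrable_on S \<alpha> J \<and>
     pos_def_hermitian_on S \<alpha> J"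

definition reeb_on :: "'e::euclidean_space set \<Rightarrow> ('e \<Rightarrow> 'e \<Rightarrow> real) \<Rightarrow> ('e \<Rightarrow> 'e) \<Rightarrow> bool" where
  "reeb_on S \<alpha> A \<longleftrightarrow> smooth_on S A \<and> (\<forall>x\<in>S. \<alpha> x (A x) = 1 \<and> (\<forall>w. ext_deriv \<alpha> x (A x) w = 0))"

definition local_flow_on ::
    "'e::euclidean_space set \<Rightarrow> ('e \<Rightarrow> 'e) \<Rightarrow> 'e set \<Rightarrow> real \<Rightarrow> (real \<Rightarrow> 'e \<Rightarrow> 'e) \<Rightarrow> bool" where
  "local_flow_on S A V \<epsilon> \<Phi> \<longleftrightarrow>
     open V \<and> V \<subseteq> S \<and> \<epsilon> > 0 \<and> smooth_on ({-\<epsilon><..<\<epsilon>} \<times> V) (\<lambda>(t, x). \<Phi> t x) \<and>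
     (\<forall>x\<in>V. \<Phi> 0 x = x \<and>
        (\<forall>t\<in>{-\<epsilon><..<\<epsilon>}. \<Phi> t x \<in> S \<and> ((\<lambda>s. \<Phi> s x) has_vector_derivative A (\<Phi> t x)) (at t)))"

text \<open>The flow of \<open>A\<close> preserves \<open>(ker \<alpha>, J)\<close>. Local flows exist around every point and are unique, and
  all time-\<open>t\<close> maps are compositions of those for small times, so one local flow around each point
  is enough.\<close>

definition flow_preserves_on ::
    "'e::euclidean_space set \<Rightarrow> ('e \<Rightarrow> 'e) \<Rightarrow> ('e \<Rightarrow> 'e \<Rightarrow> real) \<Rightarrow> ('e \<Rightarrow> 'e \<Rightarrow> 'e) \<Rightarrow> bool" where
  "flow_preserves_on S A \<alpha> J \<longleftrightarrow>
     (\<forall>p\<in>S. \<exists>V \<epsilon> \<Phi>. p \<in> V \<and> local_flow_on S A V \<epsilon> \<Phi> \<and>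
        (\<forall>t\<in>{-\<epsilon><..<\<epsilon>}. \<forall>x\<in>V. \<forall>v. \<alpha> x v = 0 \<longrightarrow>
           (let D = frechet_derivative (\<Phi> t) (at x) in
              \<alpha> (\<Phi> t x) (D v) = 0 \<and> J (\<Phi> t x) (D v) = D (J x v))))"

text \<open>\<open>\<alpha> \<cdot> \<alpha> + d\<alpha> \<circ> J\<close>, where \<open>(v, w) \<mapsto> d\<alpha>(v, Jw)\<close> is extended from \<open>ker \<alpha>\<close> to all tangent vectors
  by the projection \<open>v \<mapsto> v - \<alpha>(v)A\<close> along the Reeb field \<open>A\<close>.\<close>

definition sasaki_metric ::
    "('e::euclidean_space \<Rightarrow> 'e \<Rightarrow> real) \<Rightarrow> ('e \<Rightarrow> 'e \<Rightarrow> 'e) \<Rightarrow> ('e \<Rightarrow> 'e) \<Rightarrow> 'e \<Rightarrow> 'e \<Rightarrow> 'e \<Rightarrow> real" where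
  "sasaki_metric \<alpha> J A x v w =
     \<alpha> x v * \<alpha> x w + ext_deriv \<alpha> x (v - \<alpha> x v *\<^sub>R A x) (J x (w - \<alpha> x w *\<^sub>R A x))"


section \<open>Manifolds\<close>

text \<open>A chart is a pair of its domain and its coordinate map; the coordinate map is irrelevant outside
  the domain. A manifold is given by an atlas, and a tensor field by its coordinate
  representations in all charts of the atlas, subject to the transformation law.\<close>

type_synonym ('m, 'e) chart = "'m set \<times> ('m \<Rightarrow> 'e)"

definition chart_range :: "('m, 'e) chart \<Rightarrow> 'e set" where
  "chart_range c = snd c ` fst c"

definition overlap :: "('m, 'e) chart \<Rightarrow> ('m, 'e) chart \<Rightarrow> 'e set" where
  "overlap c d = snd c ` (fst c \<inter> fst d)"

definition chart_change :: "('m, 'e) chart \<Rightarrow> ('m, 'e) chart \<Rightarrow> 'e \<Rightarrow> 'e" where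
  "chart_change c d = snd d \<circ> inv_into (fst c) (snd c)"

definition smooth_atlas :: "'m set \<Rightarrow> ('m, 'e::euclidean_space) chart set \<Rightarrow> bool" where
  "smooth_atlas M \<A> \<longleftrightarrow>
     (\<Union>c\<in>\<A>. fst c) = M \<and> (\<forall>c\<in>\<A>. inj_on (snd c) (fst c)) \<and>
     (\<forall>c\<in>\<A>. \<forall>d\<in>\<A>. open (overlap c d) \<and> smooth_on (overlap c d) (chart_change c d))"

abbreviation transition_deriv ::
    "('m, 'e::euclidean_space) chart \<Rightarrow> ('m, 'e) chart \<Rightarrow> 'e \<Rightarrow> 'e \<Rightarrow> 'e" where
  "transition_deriv c d x \<equiv> frechet_derivative (chart_change c d) (at x)"

definition vector_field ::
    "('m, 'e::euclidean_space) chart set \<Rightarrow> (('m, 'e) chart \<Rightarrow> 'e \<Rightarrow> 'e) \<Rightarrow> bool" where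
  "vector_field \<A> X \<longleftrightarrow>
     (\<forall>c\<in>\<A>. smooth_on (chart_range c) (X c)) \<and>
     (\<forall>c\<in>\<A>. \<forall>d\<in>\<A>. \<forall>x\<in>overlap c d. transition_deriv c d x (X c x) = X d (chart_change c d x))"

definition one_form ::
    "('m, 'e::euclidean_space) chart set \<Rightarrow> (('m, 'e) chart \<Rightarrow> 'e \<Rightarrow> 'e \<Rightarrow> real) \<Rightarrow> bool" where
  "one_form \<A> \<eta> \<longleftrightarrow>
     (\<forall>c\<in>\<A>. one_form_on (chart_range c) (\<eta> c)) \<and>
     (\<forall>c\<in>\<A>. \<forall>d\<in>\<A>. \<forall>x\<in>overlap c d. \<forall>v.
        \<eta> c x v = \<eta> d (chart_change c d x) (transition_deriv c d x v))"

definition riemannian_metric ::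
    "('m, 'e::euclidean_space) chart set \<Rightarrow> (('m, 'e) chart \<Rightarrow> 'e \<Rightarrow> 'e \<Rightarrow> 'e \<Rightarrow> real) \<Rightarrow> bool" where
  "riemannian_metric \<A> g \<longleftrightarrow>
     (\<forall>c\<in>\<A>. (\<forall>v w. smooth_on (chart_range c) (\<lambda>x. g c x v w)) \<and>
        (\<forall>x\<in>chart_range c. bilinear (g c x) \<and> (\<forall>v w. g c x v w = g c x w v) \<and>
           (\<forall>v. v \<noteq> 0 \<longrightarrow> g c x v v > 0))) \<and>
     (\<forall>c\<in>\<A>. \<forall>d\<in>\<A>. \<forall>x\<in>overlap c d. \<forall>v w.
        g c x v w = g d (chart_change c d x) (transition_deriv c d x v) (transition_deriv c d x w))"

definition pseudo_hermitian ::
    "('m, 'e::euclidean_space) chart set \<Rightarrow> (('m, 'e) chart \<Rightarrow> 'e \<Rightarrow> 'e \<Rightarrow> real) \<Rightarrow>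
     (('m, 'e) chart \<Rightarrow> 'e \<Rightarrow> 'e \<Rightarrow> 'e) \<Rightarrow> bool" where
  "pseudo_hermitian \<A> \<eta> J \<longleftrightarrow>
     one_form \<A> \<eta> \<and> (\<forall>c\<in>\<A>. pseudo_hermitian_on (chart_range c) (\<eta> c) (J c)) \<and>
     (\<forall>c\<in>\<A>. \<forall>d\<in>\<A>. \<forall>x\<in>overlap c d. \<forall>v. \<eta> c x v = 0 \<longrightarrow>
        transition_deriv c d x (J c x v) = J d (chart_change c d x) (transition_deriv c d x v))"

definition reeb_field ::
    "('m, 'e::euclidean_space) chart set \<Rightarrow> (('m, 'e) chart \<Rightarrow> 'e \<Rightarrow> 'e \<Rightarrow> real) \<Rightarrow>
     (('m, 'e) chart \<Rightarrow> 'e \<Rightarrow> 'e) \<Rightarrow> bool" where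
  "reeb_field \<A> \<eta> A \<longleftrightarrow> vector_field \<A> A \<and> (\<forall>c\<in>\<A>. reeb_on (chart_range c) (\<eta> c) (A c))"

text \<open>\<open>{\<eta>, J}\<close> is a standard pseudo-Hermitian structure and \<open>g = \<eta> \<cdot> \<eta> + d\<eta> \<circ> J\<close>. The Reeb field \<open>A\<close> of the
  contact form \<open>\<eta>\<close> exists and is unique, so that the existential quantifier just names it.\<close>

definition compatible_sasaki ::
    "('m, 'e::euclidean_space) chart set \<Rightarrow> (('m, 'e) chart \<Rightarrow> 'e \<Rightarrow> 'e \<Rightarrow> 'e \<Rightarrow> real) \<Rightarrow>
     (('m, 'e) chart \<Rightarrow> 'e \<Rightarrow> 'e \<Rightarrow> real) \<Rightarrow> (('m, 'e) chart \<Rightarrow> 'e \<Rightarrow> 'e \<Rightarrow> 'e) \<Rightarrow> bool" where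
  "compatible_sasaki \<A> g \<eta> J \<longleftrightarrow>
     pseudo_hermitian \<A> \<eta> J \<and>
     (\<exists>A. reeb_field \<A> \<eta> A \<and>
        (\<forall>c\<in>\<A>. flow_preserves_on (chart_range c) (A c) (\<eta> c) (J c)) \<and>
        (\<forall>c\<in>\<A>. \<forall>x\<in>chart_range c. \<forall>v w. g c x v w = sasaki_metric (\<eta> c) (J c) (A c) x v w))"


section \<open>Quotients of Euclidean space by groups of transformations\<close>

definition orbit :: "('e \<Rightarrow> 'e) set \<Rightarrow> 'e \<Rightarrow> 'e set" where
  "orbit G x = {g x | g. g \<in> G}"

text \<open>The charts of \<open>G\<setminus>'e\<close> are the inverses of the orbit projection on the open sets on which it
  is injective.\<close>

definition quotient_atlas :: "('e::euclidean_space \<Rightarrow> 'e) set \<Rightarrow> ('e set, 'e) chart set" where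
  "quotient_atlas G = {(orbit G ` U, inv_into U (orbit G)) | U. open U \<and> inj_on (orbit G) U}"

text \<open>The metric induced on the quotient by a \<open>G\<close>-invariant metric \<open>g\<close>, i.e. the one that makes the orbit
  projection a local isometry: since the charts invert the projection locally, its coordinate
  representation is \<open>g\<close> in every chart.\<close>

definition quotient_metric ::
    "('e \<Rightarrow> 'e \<Rightarrow> 'e \<Rightarrow> real) \<Rightarrow> ('e set, 'e) chart \<Rightarrow> 'e \<Rightarrow> 'e \<Rightarrow> 'e \<Rightarrow> real" where
  "quotient_metric g c = g"


section \<open>The Heisenberg group\<close>

text \<open>The coordinates of \<open>\<complex>\<^sup>n\<close> are indexed by the finite type \<open>'n\<close>, so that \<open>n = CARD('n) \<ge> 1\<close>.\<close>

type_synonym 'n heis = "real \<times> (complex ^ 'n)"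

definition herm :: "complex ^ 'n::finite \<Rightarrow> complex ^ 'n \<Rightarrow> complex" where
  "herm z w = (\<Sum>i\<in>UNIV. cnj (z $ i) * w $ i)"

definition heis_mult :: "'n::finite heis \<Rightarrow> 'n heis \<Rightarrow> 'n heis" where
  "heis_mult = (\<lambda>(t, z) (s, w). (t + s - Im (herm z w), z + w))"

definition heis_form :: "'n::finite heis \<Rightarrow> 'n heis \<Rightarrow> real" where
  "heis_form = (\<lambda>(t, z) (a, u). a + Im (herm z u))"

text \<open>\<open>horizontal_lift (t, z) u\<close> is the tangent vector in the kernel of \<open>heis_form\<close> that projects to \<open>u\<close>.\<close>

definition horizontal_lift :: "'n::finite heis \<Rightarrow> complex ^ 'n \<Rightarrow> 'n heis" where
  "horizontal_lift = (\<lambda>(t, z) u. (- Im (herm z u), u))"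

definition heis_J :: "'n::finite heis \<Rightarrow> 'n heis \<Rightarrow> 'n heis" where
  "heis_J x v = horizontal_lift x (\<i> *s snd v)"

text \<open>\<open>(1, 0)\<close>, i.e. \<open>\<partial>/\<partial>t\<close>, is the Reeb field of \<open>heis_form\<close>.\<close>

definition heis_metric :: "'n::finite heis \<Rightarrow> 'n heis \<Rightarrow> 'n heis \<Rightarrow> real" where
  "heis_metric = sasaki_metric heis_form heis_J (\<lambda>_. (1, 0))"

definition heis_lattice :: "'n::finite heis set" where
  "heis_lattice = {(t, z). t \<in> \<int> \<and> (\<forall>i. Re (z $ i) \<in> \<int> \<and> Im (z $ i) \<in> \<int>)}"

definition heis_tau :: "'n::finite heis \<Rightarrow> 'n heis" where
  "heis_tau = (\<lambda>(t, z). (- t, \<chi> i. cnj (z $ i)))"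

text \<open>The subgroup of \<open>\<N> \<rtimes> \<langle>\<tau>\<rangle>\<close>, realised as a group of transformations of \<open>\<N>\<close>, that is generated
  by the left translations by \<open>heis_lattice\<close> and by \<open>\<mu> = \<alpha>\<^bsub>1/2\<^esub> \<tau>\<close>. The first coordinate
  of \<open>\<complex>\<^sup>n\<close> is the one with index \<open>k\<close>.\<close>

definition heis_mu :: "'n::finite \<Rightarrow> 'n heis \<Rightarrow> 'n heis" where
  "heis_mu k = heis_mult (0, axis k (1/2)) \<circ> heis_tau"

definition infra_group :: "'n::finite \<Rightarrow> ('n heis \<Rightarrow> 'n heis) set" where
  "infra_group k = generate (BijGroup UNIV) (heis_mult ` heis_lattice \<union> {heis_mu k})"


section \<open>The quotient is a manifold and the induced metric is well defined\<close>

subsection \<open>Smooth functions\<close>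

lemma Ck_on_cong:
  assumes "open S" "\<And>x. x \<in> S \<Longrightarrow> f x = g x" "Ck_on k S f"
  shows "Ck_on k S g"
  using assms(2,3)
proof (induction k arbitrary: f g)
  case 0
  then show ?case using continuous_on_cong[of S S f g] by simp
next
  case (Suc k)
  have f: "f differentiable (at x)" if "x \<in> S" for x
    using Suc.prems(2) that by simp
  have D: "(g has_derivative frechet_derivative f (at x)) (at x)" if "x \<in> S" for x
    using has_derivative_transform_within_open[OF frechet_derivative_works[THEN iffD1, OF f[OF that]]
        assms(1) that Suc.prems(1)] .
  have eq: "frechet_derivative f (at x) v = frechet_derivative g (at x) v" if "x \<in> S" for x v
    using frechet_derivative_at[OF D[OF that]] by (rule fun_cong)
  have "Ck_on k S (\<lambda>x. frechet_derivative g (at x) v)" for v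
    by (rule Suc.IH[of "\<lambda>x. frechet_derivative f (at x) v", OF eq]) (use Suc.prems(2) in simp_all)
  moreover have "g differentiable (at x)" if "x \<in> S" for x
    using D[OF that] by (rule differentiableI)
  ultimately show ?case by simp
qed

lemma Ck_on_Suc_imp: "Ck_on (Suc k) S f \<Longrightarrow> Ck_on k S f"
proof (induction k arbitrary: f)
  case 0
  then show ?case
    by (simp add: differentiable_imp_continuous_on differentiable_on_def differentiable_at_withinI)
next
  case (Suc k)
  have "Ck_on (Suc k) S (\<lambda>x. frechet_derivative f (at x) v)" for v
    using Suc.prems by (simp only: Ck_on.simps(2)[of "Suc k"])
  then have "Ck_on k S (\<lambda>x. frechet_derivative f (at x) v)" for v
    by (rule Suc.IH)
  moreover have "\<forall>x\<in>S. f differentiable (at x)"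
    using Suc.prems unfolding Ck_on.simps(2)[of "Suc k"] by (rule conjunct1)
  ultimately show ?case by simp
qed

lemma Ck_on_const: "Ck_on k S (\<lambda>x. c)"
  by (induction k arbitrary: c) (auto simp: frechet_derivative_const)

lemma Ck_on_affine:
  fixes L :: "'a::real_normed_vector \<Rightarrow> 'b::real_normed_vector"
  assumes "bounded_linear L"
  shows "Ck_on k S (\<lambda>x. L x + c)"
proof -
  have D: "((\<lambda>x. L x + c) has_derivative L) (at x)" for x
    using bounded_linear.has_derivative[OF assms has_derivative_ident]
    by (auto intro!: derivative_eq_intros)
  have "frechet_derivative (\<lambda>x. L x + c) (at x) = L" for x
    using frechet_derivative_at[OF D] by simp
  moreover have "continuous_on S (\<lambda>x. L x + c)"
    by (intro continuous_intros bounded_linear.continuous_on[OF assms])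
  ultimately show ?thesis
    using D by (cases k) (auto simp: Ck_on_const differentiable_def)
qed

lemma Ck_on_add:
  assumes "open S" "Ck_on k S f" "Ck_on k S g"
  shows "Ck_on k S (\<lambda>x. f x + g x)"
  using assms(2,3)
proof (induction k arbitrary: f g)
  case 0
  then show ?case by (simp add: continuous_on_add)
next
  case (Suc k)
  have D: "((\<lambda>x. f x + g x) has_derivative
      (\<lambda>v. frechet_derivative f (at x) v + frechet_derivative g (at x) v)) (at x)" if "x \<in> S" for x
    using Suc.prems that
    by (intro has_derivative_add frechet_derivative_works[THEN iffD1]) auto
  have "Ck_on k S (\<lambda>x. frechet_derivative (\<lambda>x. f x + g x) (at x) v)" for v
  proof (rule Ck_on_cong[OF assms(1)])
    show "Ck_on k S (\<lambda>x. frechet_derivative f (at x) v + frechet_derivative g (at x) v)"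
      using Suc.prems by (intro Suc.IH) simp_all
    fix x assume "x \<in> S"
    then show "frechet_derivative f (at x) v + frechet_derivative g (at x) v = frechet_derivative (\<lambda>x. f x + g x) (at x) v"
      by (rule fun_cong[OF frechet_derivative_at[OF D]])
  qed
  moreover have "(\<lambda>x. f x + g x) differentiable (at x)" if "x \<in> S" for x
    using D[OF that] by (rule differentiableI)
  ultimately show ?case by simp
qed

lemma Ck_on_mult:
  fixes f g :: "'a::real_normed_vector \<Rightarrow> real"
  assumes "open S" "Ck_on k S f" "Ck_on k S g"
  shows "Ck_on k S (\<lambda>x. f x * g x)"
  using assms(2,3)
proof (induction k arbitrary: f g)
  case 0
  then show ?case by (simp add: continuous_on_mult)
next
  case (Suc k)
  have D: "((\<lambda>x. f x * g x) has_derivative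
      (\<lambda>v. f x * frechet_derivative g (at x) v + frechet_derivative f (at x) v * g x)) (at x)"
    if "x \<in> S" for x
    using Suc.prems that
    by (intro has_derivative_mult frechet_derivative_works[THEN iffD1]) auto
  have "Ck_on k S (\<lambda>x. frechet_derivative (\<lambda>x. f x * g x) (at x) v)" for v
  proof (rule Ck_on_cong[OF assms(1)])
    show "Ck_on k S (\<lambda>x. f x * frechet_derivative g (at x) v + frechet_derivative f (at x) v * g x)"
      using Suc.prems Ck_on_Suc_imp[OF Suc.prems(1)] Ck_on_Suc_imp[OF Suc.prems(2)]
      by (intro Ck_on_add[OF assms(1)] Suc.IH) simp_all
    fix x assume "x \<in> S"
    then show "f x * frechet_derivative g (at x) v + frechet_derivative f (at x) v * g x = frechet_derivative (\<lambda>x. f x * g x) (at x) v"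
      by (rule fun_cong[OF frechet_derivative_at[OF D]])
  qed
  moreover have "(\<lambda>x. f x * g x) differentiable (at x)" if "x \<in> S" for x
    using D[OF that] by (rule differentiableI)
  ultimately show ?case by simp
qed

lemma Ck_on_local:
  assumes "\<And>x. x \<in> S \<Longrightarrow> \<exists>T. open T \<and> x \<in> T \<and> Ck_on k T f"
  shows "Ck_on k S f"
  using assms
proof (induction k arbitrary: f)
  case 0
  have "continuous (at x) f" if x: "x \<in> S" for x
  proof -
    obtain T where "open T" "x \<in> T" "continuous_on T f"
      using 0[OF x] by auto
    then show ?thesis by (simp add: continuous_on_eq_continuous_at)
  qed
  then show ?case by (simp add: continuous_at_imp_continuous_on)
next
  case (Suc k)
  have "f differentiable (at x)" if x: "x \<in> S" for x
    using Suc.prems[OF x] by auto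
  moreover have "Ck_on k S (\<lambda>x. frechet_derivative f (at x) v)" for v
  proof (rule Suc.IH)
    fix x assume x: "x \<in> S"
    obtain T where "open T" "x \<in> T" "Ck_on (Suc k) T f"
      using Suc.prems[OF x] by blast
    then show "\<exists>T. open T \<and> x \<in> T \<and> Ck_on k T (\<lambda>x. frechet_derivative f (at x) v)"
      by (intro exI[of _ T]) simp
  qed
  ultimately show ?case by simp
qed

lemma Ck_on_subset: "Ck_on k T f \<Longrightarrow> S \<subseteq> T \<Longrightarrow> Ck_on k S f"
  by (induction k arbitrary: f) (auto intro: continuous_on_subset)

subsection \<open>The Heisenberg group and its metric\<close>

lemma herm_add_left: "herm (z + z') w = herm z w + herm z' w"
  by (simp add: herm_def algebra_simps sum.distrib)

lemma herm_add_right: "herm z (w + w') = herm z w + herm z w'"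
  by (simp add: herm_def algebra_simps sum.distrib)

lemma herm_scaleR_left: "herm (r *\<^sub>R z) w = r *\<^sub>R herm z w"
  by (simp add: herm_def scaleR_sum_right)

lemma herm_scaleR_right: "herm z (r *\<^sub>R w) = r *\<^sub>R herm z w"
  by (simp add: herm_def scaleR_sum_right)

lemma herm_zero [simp]: "herm 0 w = 0" "herm z 0 = 0"
  by (simp_all add: herm_def)

lemma herm_minus [simp]: "herm (- z) w = - herm z w" "herm z (- w) = - herm z w"
  by (simp_all add: herm_def sum_negf)

lemma cnj_herm: "cnj (herm z w) = herm w z"
  by (simp add: herm_def mult.commute)

lemma Im_herm_swap: "Im (herm w z) = - Im (herm z w)"
  using arg_cong[OF cnj_herm[of z w], of Im] by simp

lemma herm_self: "Im (herm z z) = 0"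
  using Im_herm_swap[of z z] by simp

lemma Re_herm: "Re (herm z w) = z \<bullet> w"
  by (simp add: herm_def inner_vec_def inner_complex_def)

lemma herm_ii: "herm z (\<i> *s w) = \<i> * herm z w"
  by (simp add: herm_def vector_scalar_mult_def sum_distrib_left algebra_simps)

lemma herm_cnj: "herm (\<chi> i. cnj (z $ i)) (\<chi> i. cnj (w $ i)) = cnj (herm z w)"
  by (simp add: herm_def)

lemma heis_mult_assoc: "heis_mult (heis_mult a b) c = heis_mult a (heis_mult b c)"
  by (cases a; cases b; cases c) (simp add: heis_mult_def herm_add_left herm_add_right)

lemma heis_form_has_derivative:
  "((\<lambda>y. heis_form y w) has_derivative (\<lambda>v. Im (herm (snd v) (snd w)))) (at x)"
proof -
  have "linear (\<lambda>v :: 'a heis. Im (herm (snd v) (snd w)))"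
    by (auto intro!: linearI simp: herm_add_left herm_scaleR_left)
  then have "bounded_linear (\<lambda>v :: 'a heis. Im (herm (snd v) (snd w)))"
    by (simp add: linear_conv_bounded_linear)
  then have "((\<lambda>v :: 'a heis. Im (herm (snd v) (snd w)) + fst w) has_derivative
      (\<lambda>v. Im (herm (snd v) (snd w)))) (at x)"
    by (intro has_derivative_add_const bounded_linear_imp_has_derivative)
  moreover have "(\<lambda>y. heis_form y w) = (\<lambda>v. Im (herm (snd v) (snd w)) + fst w)"
    by (auto simp: heis_form_def fun_eq_iff split_beta)
  ultimately show ?thesis by simp
qed

lemma ext_deriv_heis_form: "ext_deriv heis_form x v w = 2 * Im (herm (snd v) (snd w))"
proof -
  have "frechet_derivative (\<lambda>y. heis_form y w) (at x) v = Im (herm (snd v) (snd w))" for v w :: "'a heis"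
    by (rule sym[OF fun_cong[OF frechet_derivative_at[OF heis_form_has_derivative]]])
  then show ?thesis
    using Im_herm_swap[of "snd w" "snd v"] by (simp add: ext_deriv_def)
qed

lemma Im_herm_J: "Im (herm u (snd (heis_J x w))) = u \<bullet> snd w"
  by (simp add: heis_J_def horizontal_lift_def split_beta herm_ii Re_herm)

lemma heis_metric_eq:
  "heis_metric x v w = heis_form x v * heis_form x w + 2 * (snd v \<bullet> snd w)"
  by (simp add: heis_metric_def sasaki_metric_def ext_deriv_heis_form Im_herm_J)

lemma heis_form_linear: "linear (heis_form x)"
  by (auto intro!: linearI simp: heis_form_def split_beta herm_add_right herm_scaleR_right
      algebra_simps)

lemma reeb_on_heis: "reeb_on UNIV heis_form (\<lambda>_. (1, 0))"
  unfolding reeb_on_def ext_deriv_heis_form by (simp add: heis_form_def split_beta smooth_on_def Ck_on_const)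

lemma pos_def_hermitian_on_heis: "pos_def_hermitian_on UNIV heis_form heis_J"
proof -
  have 1: "v = 0" if "heis_form x v = 0" "snd v = 0" for x v :: "'a heis"
    using that by (simp add: heis_form_def split_beta prod_eq_iff)
  have 2: "snd (heis_J x v) \<bullet> snd (heis_J x w) = snd v \<bullet> snd w" for x v w :: "'a heis"
    by (simp add: heis_J_def horizontal_lift_def split_beta inner_vec_def inner_complex_def add.commute)
  show ?thesis
    unfolding pos_def_hermitian_on_def Let_def ext_deriv_heis_form Im_herm_J
    using 1 by (auto simp: inner_commute 2)
qed

subsection \<open>Quotient charts\<close>

lemma frechet_derivative_cong_open:
  assumes "open T" "x \<in> T" "\<And>y. y \<in> T \<Longrightarrow> g y = f y" "(g has_derivative D) (at x)"
  shows "frechet_derivative f (at x) = D"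
  using frechet_derivative_at[OF has_derivative_transform_within_open[OF assms(4,1,2)]] assms(3)
  by simp

definition transformation_group :: "('e \<Rightarrow> 'e) set \<Rightarrow> bool" where
  "transformation_group G \<longleftrightarrow>
     id \<in> G \<and> (\<forall>g\<in>G. \<forall>h\<in>G. g \<circ> h \<in> G) \<and> (\<forall>g\<in>G. \<exists>h\<in>G. h \<circ> g = id)"

lemma orbit_eq:
  assumes "transformation_group G"
  shows "orbit G x = orbit G y \<longleftrightarrow> (\<exists>g\<in>G. y = g x)"
proof
  assume eq: "orbit G x = orbit G y"
  have "id y \<in> orbit G y"
    using assms unfolding orbit_def transformation_group_def by blast
  then show "\<exists>g\<in>G. y = g x"
    unfolding eq[symmetric] by (auto simp: orbit_def)
next
  assume "\<exists>g\<in>G. y = g x"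
  then obtain g where g: "g \<in> G" "y = g x" by blast
  obtain h where h: "h \<in> G" "h \<circ> g = id" using assms g(1) unfolding transformation_group_def by blast
  have "f x = (f \<circ> h) y" for f
    using fun_cong[OF h(2), of x] g(2) by simp
  moreover have "f y = (f \<circ> g) x" for f
    using g(2) by simp
  ultimately show "orbit G x = orbit G y"
    using assms g(1) h(1) unfolding orbit_def transformation_group_def by blast
qed

lemma quotient_chart:
  assumes "c \<in> quotient_atlas G"
  obtains U where "open U" "inj_on (orbit G) U" "c = (orbit G ` U, inv_into U (orbit G))"
  using assms unfolding quotient_atlas_def by blast

lemma quotient_chart_range:
  assumes "inj_on (orbit G) U"
  shows "chart_range (orbit G ` U, inv_into U (orbit G)) = U"
  using assms by (force simp: chart_range_def image_image)

lemma overlap_quotient: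
  assumes "inj_on (orbit G) U"
  shows "overlap (orbit G ` U, inv_into U (orbit G)) (orbit G ` V, inv_into V (orbit G)) =
    {x \<in> U. orbit G x \<in> orbit G ` V}"
proof -
  have "overlap (orbit G ` U, inv_into U (orbit G)) (orbit G ` V, inv_into V (orbit G)) =
    inv_into U (orbit G) ` orbit G ` {x \<in> U. orbit G x \<in> orbit G ` V}"
    unfolding overlap_def fst_conv snd_conv by (rule arg_cong[where f = "image _"]) blast
  also have "\<dots> = {x \<in> U. orbit G x \<in> orbit G ` V}"
    by (rule inv_into_image_cancel[OF assms]) blast
  finally show ?thesis .
qed

lemma chart_change_quotient:
  assumes "inj_on (orbit G) U" "inj_on (orbit G) V" "x \<in> U" "y \<in> V" "orbit G x = orbit G y"
  shows "chart_change (orbit G ` U, inv_into U (orbit G)) (orbit G ` V, inv_into V (orbit G)) x = y"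
proof -
  have "inj_on (inv_into U (orbit G)) (orbit G ` U)"
    by (rule inj_on_inv_into) simp
  then have "inv_into (orbit G ` U) (inv_into U (orbit G)) (inv_into U (orbit G) (orbit G x)) = orbit G x"
    by (rule inv_into_f_f) (use assms(3) in blast)
  then show ?thesis
    using assms(2,4) inv_into_f_f[OF assms(1,3)] by (simp add: chart_change_def assms(5))
qed

text \<open>For a group of diffeomorphisms, every chart change of the quotient coincides locally with an
  element of the group.\<close>

lemma quotient_local:
  assumes G: "transformation_group G" "\<forall>g\<in>G. continuous_on UNIV g"
    and c: "c \<in> quotient_atlas G" and d: "d \<in> quotient_atlas G" and x: "x \<in> overlap c d"
  obtains g T where "g \<in> G" "open T" "x \<in> T" "T \<subseteq> overlap c d" "\<And>y. y \<in> T \<Longrightarrow> chart_change c d y = g y"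
proof -
  obtain U where U: "open U" "inj_on (orbit G) U" "c = (orbit G ` U, inv_into U (orbit G))"
    using quotient_chart[OF c] .
  obtain V where V: "open V" "inj_on (orbit G) V" "d = (orbit G ` V, inv_into V (orbit G))"
    using quotient_chart[OF d] .
  note eq = orbit_eq[OF G(1)]
  have ov: "overlap c d = {x \<in> U. orbit G x \<in> orbit G ` V}"
    unfolding U(3) V(3) by (rule overlap_quotient[OF U(2)])
  obtain y where y: "y \<in> V" "orbit G x = orbit G y" "x \<in> U"
    using x unfolding ov by blast
  then obtain g where g: "g \<in> G" "y = g x" using eq by blast
  define T where "T = U \<inter> g -` V"
  have "open T"
    unfolding T_def using U(1) V(1) G(2) g(1) by (simp add: continuous_open_vimage continuous_on_eq_continuous_at open_Int)
  moreover have "x \<in> T" using y g by (simp add: T_def)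
  moreover have orb: "orbit G z = orbit G (g z)" for z using eq g(1) by blast
  then have "T \<subseteq> overlap c d" unfolding ov T_def by blast
  moreover have "chart_change c d z = g z" if "z \<in> T" for z
    unfolding U(3) V(3) using that by (intro chart_change_quotient[OF U(2) V(2) _ _ orb]) (auto simp: T_def)
  ultimately show ?thesis using that g(1) by blast
qed

lemma smooth_atlas_quotient:
  assumes G: "transformation_group G" "\<forall>g\<in>G. smooth_on UNIV g"
    and inj: "\<And>x. \<exists>U. open U \<and> x \<in> U \<and> inj_on (orbit G) U"
  shows "smooth_atlas (range (orbit G)) (quotient_atlas G)"
  unfolding smooth_atlas_def
proof (intro conjI ballI)
  have cont: "\<forall>g\<in>G. continuous_on UNIV g"
    using G(2) Ck_on.simps(1)[of UNIV] unfolding smooth_on_def by blast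
  note loc = quotient_local[OF G(1) cont]
  show "(\<Union>c\<in>quotient_atlas G. fst c) = range (orbit G)"
  proof
    show "range (orbit G) \<subseteq> (\<Union>c\<in>quotient_atlas G. fst c)"
    proof clarify
      fix x
      obtain U where U: "open U" "x \<in> U" "inj_on (orbit G) U" using inj by blast
      then have "(orbit G ` U, inv_into U (orbit G)) \<in> quotient_atlas G"
        unfolding quotient_atlas_def by blast
      moreover have "orbit G x \<in> fst (orbit G ` U, inv_into U (orbit G))" using U by simp
      ultimately show "orbit G x \<in> (\<Union>c\<in>quotient_atlas G. fst c)" by blast
    qed
  qed (auto simp: quotient_atlas_def)
  show "inj_on (snd c) (fst c)" if "c \<in> quotient_atlas G" for c
    using quotient_chart[OF that] by (metis fst_conv snd_conv inj_on_inv_into subset_refl)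
  fix c d assume cd: "c \<in> quotient_atlas G" "d \<in> quotient_atlas G"
  show "open (overlap c d)"
    unfolding open_subopen[of "overlap c d"] using loc[OF cd] by metis
  show "smooth_on (overlap c d) (chart_change c d)"
    unfolding smooth_on_def
  proof (intro allI Ck_on_local)
    fix k x assume x: "x \<in> overlap c d"
    obtain g T where g: "g \<in> G" "open T" "x \<in> T" "\<And>y. y \<in> T \<Longrightarrow> chart_change c d y = g y"
      using loc[OF cd x] by metis
    have "Ck_on k UNIV g" using G(2) g(1) by (simp add: smooth_on_def)
    then have "Ck_on k T g" by (rule Ck_on_subset) simp
    then have "Ck_on k T (chart_change c d)"
      by (rule Ck_on_cong[OF g(2), rotated]) (simp add: g(4))
    then show "\<exists>T. open T \<and> x \<in> T \<and> Ck_on k T (chart_change c d)" using g by blast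
  qed
qed

subsection \<open>The group acts properly discontinuously by isometries\<close>

lemma lattice_herm: "(s, z) \<in> heis_lattice \<Longrightarrow> (t, w) \<in> heis_lattice \<Longrightarrow> Im (herm z w) \<in> \<int>"
  by (auto simp: heis_lattice_def herm_def intro!: Ints_sum Ints_add Ints_mult Ints_diff)

lemma lattice_mult: "a \<in> heis_lattice \<Longrightarrow> b \<in> heis_lattice \<Longrightarrow> heis_mult a b \<in> heis_lattice"
  using lattice_herm[of "fst a" "snd a" "fst b" "snd b"]
  by (cases a; cases b) (simp add: heis_mult_def heis_lattice_def Ints_add Ints_diff)

lemma lattice_axis: "(0, axis k 1) \<in> heis_lattice" "(0, - axis k 1) \<in> heis_lattice"
  by (auto simp: heis_lattice_def axis_def)

lemma lattice_zero: "(0, 0) \<in> heis_lattice"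
  by (simp add: heis_lattice_def)

lemma heis_mult_zero: "heis_mult (0, 0) = id"
  by (auto simp: heis_mult_def fun_eq_iff)

lemma heis_mult_inverse: "heis_mult (- t, - z) (heis_mult (t, z) x) = x"
  by (cases x) (simp add: heis_mult_def herm_add_right herm_self)

lemma lattice_inverse:
  assumes "a \<in> heis_lattice"
  obtains b where "b \<in> heis_lattice" "heis_mult b \<circ> heis_mult a = id" "heis_mult a \<circ> heis_mult b = id"
proof -
  obtain t z where a: "a = (t, z)" by (cases a)
  have "(- t, - z) \<in> heis_lattice" using assms a by (simp add: heis_lattice_def)
  moreover have "heis_mult (- t, - z) \<circ> heis_mult a = id" "heis_mult a \<circ> heis_mult (- t, - z) = id"
    using heis_mult_inverse[of t z] heis_mult_inverse[of "- t" "- z"] by (auto simp: a)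
  ultimately show ?thesis using that by blast
qed

lemma herm_axis: "herm (axis k c) w = cnj c * w $ k"
proof -
  have "herm (axis k c) w = (\<Sum>i\<in>UNIV. if i = k then cnj c * w $ k else 0)"
    unfolding herm_def by (rule sum.cong) (auto simp: axis_def)
  then show ?thesis by simp
qed

lemma heis_mu_eq: "heis_mu k (t, z) = (- t + Im (z $ k) / 2, axis k (1/2) + (\<chi> i. cnj (z $ i)))"
  by (simp add: heis_mu_def heis_mult_def heis_tau_def herm_axis)

lemma heis_mu_mult:
  assumes "a \<in> heis_lattice"
  shows "\<exists>b\<in>heis_lattice. \<forall>x. heis_mu k (heis_mult a x) = heis_mult b (heis_mu k x)"
proof -
  obtain t z where a: "a = (t, z)" by (cases a)
  define b where "b = (- t + Im (z $ k), \<chi> i. cnj (z $ i))"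
  have "b \<in> heis_lattice" using assms by (simp add: a b_def heis_lattice_def)
  moreover have r: "herm w (axis k (1/2)) = cnj (w $ k) / 2" for w :: "complex^'a"
    using cnj_herm[of "axis k (1/2)" w] by (simp add: herm_axis)
  have "heis_mu k (heis_mult a x) = heis_mult b (heis_mu k x)" for x
    by (cases x) (simp add: a b_def heis_mu_eq heis_mult_def herm_add_right herm_cnj r vec_eq_iff
        add_divide_distrib)
  ultimately show ?thesis by blast
qed

lemma heis_mu_mu: "heis_mu k (heis_mu k x) = heis_mult (0, axis k 1) x"
  by (cases x) (simp add: heis_mu_eq heis_mult_def herm_axis, simp add: vec_eq_iff axis_def)

lemma heis_mult_comp: "heis_mult a \<circ> heis_mult b = heis_mult (heis_mult a b)"
  by (simp add: fun_eq_iff heis_mult_assoc)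

definition infra_normal_form :: "'n::finite \<Rightarrow> ('n heis \<Rightarrow> 'n heis) set" where
  "infra_normal_form k =
     heis_mult ` heis_lattice \<union> (\<lambda>a. heis_mult a \<circ> heis_mu k) ` heis_lattice"

lemma infra_normal_form_comp:
  assumes "g \<in> infra_normal_form k" "h \<in> infra_normal_form k"
  shows "g \<circ> h \<in> infra_normal_form k"
proof -
  have L: "heis_mult a \<circ> h \<in> infra_normal_form k"
    if "a \<in> heis_lattice" "h \<in> infra_normal_form k" for a h
    using that lattice_mult[of a]
    by (auto simp: infra_normal_form_def heis_mult_comp simp flip: comp_assoc)
  have M: "heis_mu k \<circ> h \<in> infra_normal_form k" if h: "h \<in> infra_normal_form k" for h
  proof -
    obtain a where a: "a \<in> heis_lattice" "h = heis_mult a \<or> h = heis_mult a \<circ> heis_mu k"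
      using h unfolding infra_normal_form_def by blast
    obtain b where b: "b \<in> heis_lattice" "heis_mu k \<circ> heis_mult a = heis_mult b \<circ> heis_mu k"
      using heis_mu_mult[OF a(1), of k] unfolding fun_eq_iff comp_def by blast
    have mm: "heis_mu k \<circ> heis_mu k = heis_mult (0, axis k 1)"
      by (simp add: fun_eq_iff heis_mu_mu)
    from a(2) show ?thesis
    proof
      assume "h = heis_mult a"
      then show ?thesis using b by (auto simp: infra_normal_form_def)
    next
      assume "h = heis_mult a \<circ> heis_mu k"
      then have "heis_mu k \<circ> h = heis_mult b \<circ> heis_mult (0, axis k 1)"
        using b(2) mm by (metis comp_assoc)
      then show ?thesis
        using b(1) lattice_mult[OF b(1) lattice_axis(1)]
        by (simp add: infra_normal_form_def heis_mult_comp)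
    qed
  qed
  obtain a where "a \<in> heis_lattice" "g = heis_mult a \<or> g = heis_mult a \<circ> heis_mu k"
    using assms(1) unfolding infra_normal_form_def by blast
  then show ?thesis
    using L[OF _ assms(2)] L[OF _ M[OF assms(2)]] by (metis comp_assoc)
qed

lemma infra_generators:
  assumes "h \<in> heis_mult ` heis_lattice \<union> {heis_mu k}"
  obtains h' where "h' \<in> infra_normal_form k" "h' \<circ> h = id" "h \<circ> h' = id"
proof (cases "h = heis_mu k")
  case True
  let ?e = "heis_mult (0, - axis k 1) \<circ> heis_mu k"
  have "?e \<in> infra_normal_form k" using lattice_axis(2) by (auto simp: infra_normal_form_def)
  moreover have "?e \<circ> heis_mu k = id"
    using heis_mult_inverse[of 0 "axis k 1"] by (simp add: fun_eq_iff heis_mu_mu)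
  moreover have "heis_mu k \<circ> ?e = id"
  proof
    fix x :: "'a heis"
    obtain t z where x: "x = (t, z)" by (cases x)
    have "axis k (1/2) + (\<chi> i. cnj ((axis k (1/2) + (\<chi> i. cnj (z $ i)) - axis k 1) $ i)) = z"
      by (simp add: vec_eq_iff axis_def)
    then show "(heis_mu k \<circ> ?e) x = id x"
      by (simp add: x heis_mu_eq heis_mult_def herm_axis axis_nth)
  qed
  ultimately show ?thesis using that True by blast
next
  case False
  then obtain a where a: "a \<in> heis_lattice" "h = heis_mult a" using assms by blast
  obtain b where b: "b \<in> heis_lattice" "heis_mult b \<circ> heis_mult a = id" "heis_mult a \<circ> heis_mult b = id"
    using lattice_inverse[OF a(1)] .
  show ?thesis
    by (rule that[of "heis_mult b"]) (simp_all add: a(2) b infra_normal_form_def)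
qed

lemma infra_generators_Bij: "heis_mult ` heis_lattice \<union> {heis_mu k} \<subseteq> carrier (BijGroup UNIV)"
proof
  fix h assume "h \<in> heis_mult ` heis_lattice \<union> {heis_mu k}"
  then obtain h' where "h' \<circ> h = id" "h \<circ> h' = id" using infra_generators by blast
  then have "bij h" by (rule o_bij)
  then show "h \<in> carrier (BijGroup UNIV)" by (simp add: BijGroup_def Bij_def)
qed

lemma infra_group_normal_form: "infra_group k \<subseteq> infra_normal_form k"
proof
  fix g assume "g \<in> infra_group k"
  then have "g \<in> generate (BijGroup UNIV) (heis_mult ` heis_lattice \<union> {heis_mu k})"
    by (simp add: infra_group_def)
  then have "g \<in> infra_normal_form k \<and> g \<in> Bij UNIV"
  proof induction
    case one
    have "id \<in> infra_normal_form k"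
      using lattice_zero unfolding infra_normal_form_def heis_mult_zero[symmetric] by blast
    then show ?case
      using bij_id by (simp add: BijGroup_def Bij_def id_def)
  next
    case (incl h)
    have "heis_mu k = heis_mult (0, 0) \<circ> heis_mu k"
      by (simp add: heis_mult_zero)
    then have "heis_mu k \<in> infra_normal_form k"
      using lattice_zero unfolding infra_normal_form_def by blast
    then have "h \<in> infra_normal_form k"
      using incl unfolding infra_normal_form_def by blast
    then show ?case
      using incl infra_generators_Bij[of k] by (auto simp: BijGroup_def)
  next
    case (inv h)
    then obtain h' where h': "h' \<in> infra_normal_form k" "h' \<circ> h = id" "h \<circ> h' = id"
      using infra_generators by blast
    have "h \<in> Bij UNIV" using inv infra_generators_Bij[of k] by (auto simp: BijGroup_def)
    then have "inv\<^bsub>BijGroup UNIV\<^esub> h = inv_into UNIV h"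
      by (simp add: inv_BijGroup restrict_def)
    also have "\<dots> = h'" by (rule inv_unique_comp[OF h'(3,2)])
    finally show ?case using h' o_bij[OF h'(3,2)] by (simp add: Bij_def)
  next
    case (eng g h)
    then have "g \<otimes>\<^bsub>BijGroup UNIV\<^esub> h = g \<circ> h"
      by (simp add: BijGroup_def compose_def comp_def restrict_def)
    then show ?case
      using eng infra_normal_form_comp[of g k h] bij_comp[of h g] by (simp add: Bij_def comp_def)
  qed
  then show "g \<in> infra_normal_form k" by simp
qed

lemma transformation_group_infra: "transformation_group (infra_group k)"
proof -
  interpret B: group "BijGroup (UNIV :: 'a heis set)" by (rule group_BijGroup)
  have S: "subgroup (infra_group k) (BijGroup UNIV)"
    unfolding infra_group_def by (rule B.generate_is_subgroup[OF infra_generators_Bij])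
  have B: "infra_group k \<subseteq> Bij UNIV"
    using subgroup.subset[OF S] by (simp add: BijGroup_def)
  have "id \<in> infra_group k"
    using subgroup.one_closed[OF S] by (simp add: BijGroup_def id_def restrict_def)
  moreover have "g \<circ> h \<in> infra_group k" if "g \<in> infra_group k" "h \<in> infra_group k" for g h
  proof -
    have "g \<in> Bij UNIV" "h \<in> Bij UNIV" using that B by blast+
    then have "g \<otimes>\<^bsub>BijGroup UNIV\<^esub> h = g \<circ> h"
      by (simp add: BijGroup_def compose_def comp_def restrict_def)
    then show ?thesis using subgroup.m_closed[OF S that] by simp
  qed
  moreover have "\<exists>h\<in>infra_group k. h \<circ> g = id" if "g \<in> infra_group k" for g
  proof -
    have "g \<in> Bij UNIV" using that B by blast
    then have "inv_into UNIV g \<in> infra_group k" "bij g"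
      using subgroup.m_inv_closed[OF S that] by (simp_all add: inv_BijGroup Bij_def restrict_def)
    then show ?thesis using inv_o_cancel[OF bij_is_inj] by blast
  qed
  ultimately show ?thesis by (simp add: transformation_group_def)
qed

lemma Ints_small: "x \<in> \<int> \<Longrightarrow> \<bar>x\<bar> < 1/2 \<Longrightarrow> x = (0::real)"
  by (auto simp: Ints_def)

text \<open>Hence the action is free and properly discontinuous.\<close>

lemma infra_group_separated:
  assumes "g \<in> infra_group k" "dist (g x) x < 1/2"
  shows "g = id"
proof -
  obtain s z where x: "x = (s, z)" by (cases x)
  have le: "cmod ((w - z) $ i) < 1/2" "\<bar>t - s\<bar> < 1/2" if "dist (t, w) x < 1/2" for t w i
    using that Finite_Cartesian_Product.norm_nth_le[of "w - z" i] norm_snd_le[of "w - z" "t - s"] norm_fst_le[of "t - s" "w - z"]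
    by (auto simp: x dist_norm)
  have "g \<in> infra_normal_form k" using assms(1) infra_group_normal_form by blast
  then obtain a where a: "a \<in> heis_lattice" "g = heis_mult a \<or> g = heis_mult a \<circ> heis_mu k"
    unfolding infra_normal_form_def by blast
  obtain m b where mb: "a = (m, b)" by (cases a)
  have int: "m \<in> \<int>" "Re (b $ i) \<in> \<int>" "Im (b $ i) \<in> \<int>" for i
    using a(1) by (simp_all add: mb heis_lattice_def)
  from a(2) show ?thesis
  proof
    assume g: "g = heis_mult a"
    then have gx: "g x = (m + s - Im (herm b z), b + z)" by (simp add: mb x heis_mult_def)
    have "b $ i = 0" for i
    proof -
      have "cmod (b $ i) < 1/2" using le(1)[OF assms(2)[unfolded gx], of i] by simp
      then have "\<bar>Re (b $ i)\<bar> < 1/2" "\<bar>Im (b $ i)\<bar> < 1/2"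
        using abs_Re_le_cmod[of "b $ i"] abs_Im_le_cmod[of "b $ i"] by linarith+
      then show ?thesis using int Ints_small by (simp add: complex_eq_iff)
    qed
    then have b: "b = 0" by (simp add: vec_eq_iff)
    then have "m = 0" using le(2)[OF assms(2)[unfolded gx]] int(1) Ints_small by simp
    then show ?thesis using b by (auto simp: g mb heis_mult_def fun_eq_iff)
  next
    assume g: "g = heis_mult a \<circ> heis_mu k"
    have "snd (g x) = b + (axis k (1/2) + (\<chi> i. cnj (z $ i)))"
      by (simp add: g mb x heis_mult_def heis_mu_eq)
    moreover have "cmod ((snd (g x) - z) $ k) < 1/2"
      using le(1)[of "fst (g x)" "snd (g x)" k] assms(2) by simp
    ultimately have "\<bar>Re (b $ k) + 1/2\<bar> < 1/2"
      using abs_Re_le_cmod[of "(snd (g x) - z) $ k"] by (simp add: axis_def)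
    moreover obtain j where "Re (b $ k) = of_int j" using int(2)[of k] by (auto elim: Ints_cases)
    ultimately have "\<bar>real_of_int j + 1/2\<bar> < 1/2" by simp
    then have "real_of_int j < 0" "real_of_int j > -1" by linarith+
    then show ?thesis by simp
  qed
qed

text \<open>All elements of the group are affine maps preserving \<open>heis_form\<close> up to sign.\<close>

definition affine_form_preserving :: "('n::finite heis \<Rightarrow> 'n heis) \<Rightarrow> bool" where
  "affine_form_preserving g \<longleftrightarrow>
     (\<exists>L c s. linear L \<and> g = (\<lambda>x. L x + c) \<and> (s = 1 \<or> s = (-1::real)) \<and>
        (\<forall>x v. heis_form (g x) (L v) = s * heis_form x v) \<and>
        (\<forall>v w. snd (L v) \<bullet> snd (L w) = snd v \<bullet> snd w))"

lemma infra_group_affine: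
  fixes g :: "'n::finite heis \<Rightarrow> 'n heis"
  assumes "g \<in> infra_group k"
  shows "affine_form_preserving g"
proof -
  have comp: "affine_form_preserving (g \<circ> h)" if "affine_form_preserving g" "affine_form_preserving h" for g h :: "'n heis \<Rightarrow> 'n heis"
  proof -
    obtain L c s where 1: "linear L" "g = (\<lambda>x. L x + c)" "s = 1 \<or> s = (-1::real)"
      "\<And>x v. heis_form (g x) (L v) = s * heis_form x v" "\<And>v w. snd (L v) \<bullet> snd (L w) = snd v \<bullet> snd w"
      using \<open>affine_form_preserving g\<close> unfolding affine_form_preserving_def by blast
    obtain L' c' s' where 2: "linear L'" "h = (\<lambda>x. L' x + c')" "s' = 1 \<or> s' = (-1::real)"
      "\<And>x v. heis_form (h x) (L' v) = s' * heis_form x v" "\<And>v w. snd (L' v) \<bullet> snd (L' w) = snd v \<bullet> snd w"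
      using \<open>affine_form_preserving h\<close> unfolding affine_form_preserving_def by blast
    have "linear (L \<circ> L')" using 1(1) 2(1) by (rule linear_compose[rotated])
    moreover have "g \<circ> h = (\<lambda>x. (L \<circ> L') x + (L c' + c))"
      by (simp add: fun_eq_iff 1(2) 2(2) linear_add[OF 1(1)])
    moreover have "s * s' = 1 \<or> s * s' = -1" using 1(3) 2(3) by auto
    moreover have "heis_form ((g \<circ> h) x) ((L \<circ> L') v) = s * s' * heis_form x v" for x v
      using 1(4)[of "h x"] 2(4) by simp
    moreover have "snd ((L \<circ> L') v) \<bullet> snd ((L \<circ> L') w) = snd v \<bullet> snd w" for v w
      using 1(5) 2(5) by simp
    ultimately show ?thesis unfolding affine_form_preserving_def by blast
  qed
  have mult: "affine_form_preserving (heis_mult a)" for a :: "'n heis"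
  proof -
    obtain m b where a: "a = (m, b)" by (cases a)
    let ?L = "\<lambda>v :: 'n heis. (fst v - Im (herm b (snd v)), snd v)"
    have "linear ?L"
      by (auto intro!: linearI simp: herm_add_right herm_scaleR_right algebra_simps)
    moreover have "heis_mult a = (\<lambda>x. ?L x + a)"
      by (auto simp: a heis_mult_def fun_eq_iff)
    moreover have "heis_form (heis_mult a x) (?L v) = 1 * heis_form x v" for x v
      by (simp add: a heis_mult_def heis_form_def split_beta herm_add_left)
    ultimately show ?thesis unfolding affine_form_preserving_def by (intro exI[of _ ?L] exI[of _ a] exI[of _ "1 :: real"]) simp
  qed
  have tau: "affine_form_preserving (heis_tau :: 'n heis \<Rightarrow> _)"
  proof -
    have "linear (heis_tau :: 'n heis \<Rightarrow> _)"
      by (auto intro!: linearI simp: heis_tau_def vec_eq_iff split_beta)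
    moreover have "heis_form (heis_tau x) (heis_tau v) = - 1 * heis_form x v" for x v :: "'n heis"
      by (simp add: heis_tau_def heis_form_def split_beta herm_cnj)
    moreover have "snd (heis_tau v) \<bullet> snd (heis_tau w) = snd v \<bullet> snd w" for v w :: "'n heis"
      by (simp add: heis_tau_def split_beta inner_vec_def inner_complex_def)
    ultimately show ?thesis
      unfolding affine_form_preserving_def by (intro exI[of _ heis_tau] exI[of _ "0 :: 'n heis"] exI[of _ "-1 :: real"]) simp
  qed
  have "g \<in> infra_normal_form k" using assms infra_group_normal_form by blast
  then show ?thesis
    using mult comp[OF mult comp[OF mult tau]]
    by (auto simp: infra_normal_form_def heis_mu_def)
qed

lemma infra_group_has_derivative:
  fixes L :: "'n::finite heis \<Rightarrow> 'n heis"
  assumes "linear L" "g = (\<lambda>x. L x + c)"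
  shows "(g has_derivative L) (at x)"
  unfolding assms(2)
  by (intro has_derivative_add_const bounded_linear_imp_has_derivative)
    (use assms(1) in \<open>simp add: linear_conv_bounded_linear\<close>)

lemma infra_group_smooth:
  assumes "g \<in> infra_group k"
  shows "smooth_on UNIV g"
proof -
  obtain L c s where L: "linear L" "g = (\<lambda>x. L x + c)" "s = 1 \<or> s = (-1::real)"
    "\<And>x v. heis_form (g x) (L v) = s * heis_form x v" "\<And>v w. snd (L v) \<bullet> snd (L w) = snd v \<bullet> snd w"
    using infra_group_affine[OF assms] unfolding affine_form_preserving_def by blast
  have "bounded_linear L" using L(1) by (simp add: linear_conv_bounded_linear)
  then show ?thesis unfolding smooth_on_def L(2) by (intro allI Ck_on_affine)
qed

theorem smooth_atlas_infra: "smooth_atlas (range (orbit (infra_group k))) (quotient_atlas (infra_group k))"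
proof (rule smooth_atlas_quotient[OF transformation_group_infra])
  show "\<forall>g\<in>infra_group k. smooth_on UNIV g"
    using infra_group_smooth by blast
  fix x :: "'a heis"
  have "inj_on (orbit (infra_group k)) (ball x (1/4))"
  proof (rule inj_onI)
    fix y z assume yz: "y \<in> ball x (1/4)" "z \<in> ball x (1/4)"
      and "orbit (infra_group k) y = orbit (infra_group k) z"
    then obtain g where g: "g \<in> infra_group k" "z = g y"
      using orbit_eq[OF transformation_group_infra] by blast
    have "dist z y < 1/2"
      using yz dist_triangle_half_r[of x z "1/2" y] by (simp add: mem_ball)
    then show "y = z" using infra_group_separated[OF g(1), of y] g(2) by simp
  qed
  then show "\<exists>U. open U \<and> x \<in> U \<and> inj_on (orbit (infra_group k)) U"
    by (intro exI[of _ "ball x (1/4)"]) simp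
qed

theorem riemannian_metric_infra:
  fixes k :: "'n::finite"
  shows "riemannian_metric (quotient_atlas (infra_group k)) (quotient_metric heis_metric)"
  unfolding riemannian_metric_def quotient_metric_def
proof (intro conjI ballI allI impI)
  fix c assume c: "c \<in> quotient_atlas (infra_group k)"
  obtain U where U: "open U" "chart_range c = U"
    using quotient_chart[OF c] quotient_chart_range by metis
  have "Ck_on j U (\<lambda>x. heis_metric x v w)" for j and v w :: "'n heis"
  proof -
    have "Ck_on j U (\<lambda>x. heis_form x v)" for v :: "'n heis"
    proof -
      have "linear (\<lambda>x :: 'n heis. Im (herm (snd x) (snd v)))"
        by (auto intro!: linearI simp: herm_add_left herm_scaleR_left)
      then have C: "Ck_on j U (\<lambda>x. Im (herm (snd x) (snd v)) + fst v)"
        by (intro Ck_on_affine) (simp add: linear_conv_bounded_linear)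
      have eq: "(\<lambda>x. heis_form x v) = (\<lambda>x. Im (herm (snd x) (snd v)) + fst v)"
        by (auto simp: heis_form_def fun_eq_iff split_beta)
      show ?thesis unfolding eq by (rule C)
    qed
    then show ?thesis
      unfolding heis_metric_eq by (intro Ck_on_add Ck_on_mult Ck_on_const U(1))
  qed
  then show "smooth_on (chart_range c) (\<lambda>x. heis_metric x v w)" for v w
    by (simp add: smooth_on_def U(2))
  fix x :: "'n heis"
  show "bilinear (heis_metric x)"
    unfolding bilinear_def heis_metric_eq
    by (intro conjI allI linearI)
      (simp_all add: linear_add[OF heis_form_linear] linear_cmul[OF heis_form_linear]
        inner_add_left inner_add_right algebra_simps del: split_paired_All)
  show "heis_metric x v w = heis_metric x w v" for v w
    by (simp add: heis_metric_eq inner_commute)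
  fix v :: "'n heis" assume "v \<noteq> 0"
  moreover have "v = 0" if "heis_form x v = 0" "snd v = 0"
    using that by (simp add: heis_form_def split_beta prod_eq_iff)
  ultimately have "heis_form x v \<noteq> 0 \<or> snd v \<noteq> 0" by blast
  then have "heis_form x v * heis_form x v > 0 \<or> snd v \<bullet> snd v > 0"
    by (metis inner_gt_zero_iff not_real_square_gt_zero)
  then show "heis_metric x v v > 0"
    using inner_ge_zero[of "snd v"] zero_le_square[of "heis_form x v"] unfolding heis_metric_eq by linarith
next
  fix c d x v w
  assume cd: "c \<in> quotient_atlas (infra_group k)" "d \<in> quotient_atlas (infra_group k)"
    and x: "x \<in> overlap c d"
  have aff: "\<forall>g\<in>infra_group k. continuous_on UNIV g"
    using infra_group_smooth Ck_on.simps(1) unfolding smooth_on_def by blast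
  obtain g T where g: "g \<in> infra_group k" "open T" "x \<in> T" "T \<subseteq> overlap c d" "\<And>y. y \<in> T \<Longrightarrow> chart_change c d y = g y"
    by (rule quotient_local[OF transformation_group_infra aff cd x]) blast
  obtain L b s where L: "linear L" "g = (\<lambda>x. L x + b)" "s = 1 \<or> s = (-1::real)"
    "\<And>x v. heis_form (g x) (L v) = s * heis_form x v" "\<And>v w. snd (L v) \<bullet> snd (L w) = snd v \<bullet> snd w"
    using infra_group_affine[OF g(1)] unfolding affine_form_preserving_def by blast
  have "transition_deriv c d x = L"
    using frechet_derivative_cong_open[OF g(2,3) _ infra_group_has_derivative[OF L(1,2)]] g(5) by simp
  moreover have "chart_change c d x = g x" using g by simp
  ultimately show "heis_metric x v w =
      heis_metric (chart_change c d x) (transition_deriv c d x v) (transition_deriv c d x w)"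
    using L(3) by (auto simp: heis_metric_eq L(4,5))
qed

end

theory Submission
  imports Defs
begin

text \<open>The Reeb field of a compatible Sasaki structure is, up to sign, the central field
  \<open>\<partial>/\<partial>t\<close>, because this is true already locally on the Heisenberg group; but \<open>\<mu>\<close> reverses the central
  direction, so that neither sign descends to the quotient.

  The local rigidity is a consequence of the Sasaki equations at second order. Let \<open>A\<close> be the Reeb
  field of a Sasaki structure \<open>{\<eta>, J}\<close> on an open set with \<open>\<eta> \<cdot> \<eta> + d\<eta> \<circ> J = g\<^sub>0\<close>. Its flow preserves
  \<open>\<eta>\<close> and \<open>J\<close>, hence \<open>g\<^sub>0\<close>, so \<open>A\<close> is a Killing field of unit length (\<open>reeb_field_killing\<close>). Let \<open>T\<close> be
  the central field \<open>\<partial>/\<partial>t\<close>, write \<open>X\<^sub>u\<close> for the left-invariant horizontal field over \<open>u \<in> \<complex>\<^sup>n\<close>, and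
  decompose \<open>A = a T + X\<^sub>b\<close>, so that \<open>a\<^sup>2 + 2|b|\<^sup>2 = 1\<close>. In this frame the Killing equation
  implies that \<open>X\<^sub>u a + 2 \<langle>T b, u\<rangle> = 2 Im \<langle>u, b\<rangle>\<close> and that \<open>H(u, v) = X\<^sub>u\<langle>b, v\<rangle>\<close> is skew.

  Applying the horizontal Laplacian \<open>\<Sum>\<^sub>j X\<^sub>j X\<^sub>j\<close> (\<open>j\<close> running over an orthonormal basis of \<open>\<complex>\<^sup>n\<close>) to
  \<open>a\<^sup>2 + 2|b|\<^sup>2 = 1\<close> and commuting derivatives gives an identity between \<open>a\<close>, \<open>b\<close>, \<open>T b\<close> and \<open>H\<close> that
  contains no second derivatives; it plays the role of the Bochner formula
  \<open>|\<nabla>A|\<^sup>2 = Ric(A, A)\<close> for a unit Killing field. On the other hand the first derivatives of \<open>A\<close> are the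
  coefficients of \<open>d\<eta>\<close>, and \<open>d\<eta> = g\<^sub>0(\<cdot>, \<phi> \<cdot>)\<close> for an endomorphism \<open>\<phi>\<close> that kills \<open>A\<close> and is isometric
  on \<open>ker \<eta>\<close> (\<open>sasaki_structure_tensor\<close>). This fixes the sizes of the vertical and of the horizontal
  part of \<open>d\<eta>\<close> in terms of \<open>|b|\<^sup>2\<close>. Together the equations leave \<open>(2n + 2)|b|\<^sup>2 = 0\<close>
  (\<open>snd_A_zero\<close>); in curvature terms, \<open>Ric(A, A)\<close> is prescribed for a Reeb field, and for the
  Heisenberg metric that value is attained only in the central direction.

  So \<open>\<omega>\<^sub>0(A) = \<plusminus>1\<close> everywhere. Lifting \<open>A\<close> through small charts makes \<open>\<omega>\<^sub>0(A)\<close> a continuous function on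
  the connected space \<open>\<N>\<close>, hence constant, whereas \<open>\<mu>\<^sup>* \<omega>\<^sub>0 = -\<omega>\<^sub>0\<close> and invariance of \<open>A\<close> under \<open>\<mu>\<close> make
  it change sign.\<close>

section \<open>Symmetry of second derivatives\<close>

abbreviation D :: "('a::real_normed_vector \<Rightarrow> 'b::real_normed_vector) \<Rightarrow> 'a \<Rightarrow> 'a \<Rightarrow> 'b" where
  "D f x \<equiv> frechet_derivative f (at x)"

lemma smooth_on_has_derivative:
  assumes "smooth_on S f" "x \<in> S"
  shows "(f has_derivative D f x) (at x)"
proof -
  have "Ck_on (Suc 0) S f" using assms(1) unfolding smooth_on_def by blast
  then show ?thesis using assms(2) by (simp add: frechet_derivative_works)
qed

lemma smooth_on_D: "smooth_on S f \<Longrightarrow> smooth_on S (\<lambda>x. D f x v)"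
  unfolding smooth_on_def using Ck_on.simps(2) by blast

lemma smooth_on_continuous: "smooth_on S f \<Longrightarrow> continuous_on S f"
  unfolding smooth_on_def using Ck_on.simps(1) by blast

lemma smooth_on_bounded_linear:
  assumes "open S" "smooth_on S f" "bounded_linear L"
  shows "smooth_on S (\<lambda>x. L (f x))"
  unfolding smooth_on_def
proof
  fix k
  have "Ck_on k S f" using assms(2) by (simp add: smooth_on_def)
  then show "Ck_on k S (\<lambda>x. L (f x))"
  proof (induction k arbitrary: f)
    case 0
    then show ?case using bounded_linear.continuous_on[OF assms(3)] by simp
  next
    case (Suc k)
    have *: "((\<lambda>x. L (f x)) has_derivative (\<lambda>v. L (D f x v))) (at x)" if "x \<in> S" for x
      by (rule bounded_linear.has_derivative[OF assms(3)])
        (use Suc.prems that in \<open>simp add: frechet_derivative_works\<close>)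
    have "Ck_on k S (\<lambda>x. D (\<lambda>x. L (f x)) x v)" for v
      by (rule Ck_on_cong[OF assms(1) _ Suc.IH[of "\<lambda>x. D f x v"]])
        (use Suc.prems frechet_derivative_at[OF *] in \<open>auto simp: fun_eq_iff\<close>)
    then show ?case using * by (auto simp: differentiable_def)
  qed
qed

lemma D_linear:
  assumes "smooth_on S f" "x \<in> S"
  shows "linear (D f x)"
  using smooth_on_has_derivative[OF assms] has_derivative_linear by blast

lemma D_eqI: "(f has_derivative f') (at x) \<Longrightarrow> D f x v = f' v"
  using frechet_derivative_at by metis

lemma has_real_derivative_along_line:
  assumes "(f has_derivative f') (at (p + s *\<^sub>R w))"
  shows "((\<lambda>s. f (p + s *\<^sub>R w)) has_real_derivative f' w) (at s)"
proof -
  have "((\<lambda>s. p + s *\<^sub>R w) has_derivative (\<lambda>h. h *\<^sub>R w)) (at s)"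
    by (auto intro!: derivative_eq_intros)
  from has_derivative_compose[OF this assms]
  have "((\<lambda>s. f (p + s *\<^sub>R w)) has_derivative (\<lambda>h. f' (h *\<^sub>R w))) (at s)" .
  moreover have "(\<lambda>h. f' (h *\<^sub>R w)) = (*) (f' w)"
    using linear_cmul[OF has_derivative_linear[OF assms]] by (auto simp: mult.commute)
  ultimately show ?thesis by (simp add: has_field_derivative_def)
qed

text \<open>The mean value theorem once in each direction. Which of the two second derivatives occurs depends
  on the order of \<open>v\<close> and \<open>w\<close>, whereas the second difference does not; letting \<open>h\<close> tend to 0 then
  identifies the two.\<close>

lemma second_difference_mean_value:
  fixes f :: "'a::real_normed_vector \<Rightarrow> real"
  assumes f: "smooth_on S f" and h: "0 < h"
    and S: "\<And>s t. 0 \<le> s \<Longrightarrow> s \<le> h \<Longrightarrow> 0 \<le> t \<Longrightarrow> t \<le> h \<Longrightarrow> x + s *\<^sub>R v + t *\<^sub>R w \<in> S"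
  obtains s t where "0 < s" "s < h" "0 < t" "t < h"
    "f (x + h *\<^sub>R v + h *\<^sub>R w) - f (x + h *\<^sub>R v) - f (x + h *\<^sub>R w) + f x =
       h * (h * D (\<lambda>y. D f y v) (x + s *\<^sub>R v + t *\<^sub>R w) w)"
proof -
  define \<psi> where "\<psi> s = f ((x + h *\<^sub>R w) + s *\<^sub>R v) - f (x + s *\<^sub>R v)" for s
  have "(\<psi> has_real_derivative D f ((x + h *\<^sub>R w) + s *\<^sub>R v) v - D f (x + s *\<^sub>R v) v) (at s)"
    if "0 \<le> s" "s \<le> h" for s
    unfolding \<psi>_def
    using S[of s h] S[of s 0] that h
    by (intro DERIV_diff has_real_derivative_along_line smooth_on_has_derivative[OF f])
      (simp_all add: algebra_simps)
  from MVT2[OF h this] obtain s where s: "0 < s" "s < h"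
    "\<psi> h - \<psi> 0 = h * (D f ((x + h *\<^sub>R w) + s *\<^sub>R v) v - D f (x + s *\<^sub>R v) v)" by auto
  have "((\<lambda>t. D f ((x + s *\<^sub>R v) + t *\<^sub>R w) v) has_real_derivative
      D (\<lambda>y. D f y v) ((x + s *\<^sub>R v) + t *\<^sub>R w) w) (at t)" if "0 \<le> t" "t \<le> h" for t
    using S[of s t] that s
    by (intro has_real_derivative_along_line smooth_on_has_derivative[OF smooth_on_D[OF f]]) simp
  from MVT2[OF h this] obtain t where t: "0 < t" "t < h"
    "D f ((x + s *\<^sub>R v) + h *\<^sub>R w) v - D f (x + s *\<^sub>R v) v = h * D (\<lambda>y. D f y v) ((x + s *\<^sub>R v) + t *\<^sub>R w) w"
    by auto
  show ?thesis
    by (rule that[OF s(1,2) t(1,2)]) (use s(3) t(3) in \<open>simp add: \<psi>_def algebra_simps\<close>)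
qed

lemma second_derivative_symmetric_real:
  fixes f :: "'a::real_normed_vector \<Rightarrow> real"
  assumes S: "open S" and f: "smooth_on S f" and x: "x \<in> S"
  shows "D (\<lambda>y. D f y v) x w = D (\<lambda>y. D f y w) x v"
proof (rule ccontr)
  define P where "P y = D (\<lambda>y. D f y v) y w" for y
  define Q where "Q y = D (\<lambda>y. D f y w) y v" for y
  assume neq: "\<not> ?thesis"
  define e where "e = \<bar>P x - Q x\<bar> / 2"
  have e: "e > 0" using neq by (simp add: e_def P_def Q_def)
  have "continuous_on S P" "continuous_on S Q"
    unfolding P_def Q_def by (intro smooth_on_continuous smooth_on_D f)+
  then have "isCont P x" "isCont Q x"
    using S x by (simp_all add: continuous_on_eq_continuous_at)
  then obtain d1 d2 where d1: "d1 > 0" "\<And>y. dist y x < d1 \<Longrightarrow> dist (P y) (P x) < e"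
    and d2: "d2 > 0" "\<And>y. dist y x < d2 \<Longrightarrow> dist (Q y) (Q x) < e"
    unfolding continuous_at_eps_delta using e by metis
  obtain d3 where d3: "d3 > 0" "\<And>y. dist y x < d3 \<Longrightarrow> y \<in> S"
    using S x unfolding open_dist by blast
  define d where "d = min d1 (min d2 d3)"
  have d: "d > 0" using d1 d2 d3 by (simp add: d_def)
  \<comment> \<open>Small enough for the parallelogram with sides \<open>h v\<close>, \<open>h w\<close> at \<open>x\<close> to lie in the ball of radius \<open>d\<close>.\<close>
  define h where "h = d / (2 * (norm v + norm w + 1))"
  have h: "h > 0" using d by (simp add: h_def add_nonneg_pos)
  have near: "dist (x + s *\<^sub>R v + t *\<^sub>R w) x < d" if "0 \<le> s" "s \<le> h" "0 \<le> t" "t \<le> h" for s t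
  proof -
    have "dist (x + s *\<^sub>R v + t *\<^sub>R w) x = norm (s *\<^sub>R v + t *\<^sub>R w)"
      by (simp add: dist_norm algebra_simps)
    also have "\<dots> \<le> s * norm v + t * norm w"
      using norm_triangle_ineq[of "s *\<^sub>R v" "t *\<^sub>R w"] that by simp
    also have "\<dots> \<le> h * norm v + h * norm w"
      using that by (intro add_mono mult_right_mono) auto
    also have "\<dots> \<le> h * (norm v + norm w + 1)" using h by (simp add: algebra_simps)
    also have "\<dots> = d / 2"
    proof -
      have *: "d / (2 * N) * N = d / 2" if "N > 0" for N using that by simp
      show ?thesis unfolding h_def by (rule *) (simp add: add_nonneg_pos)
    qed
    also have "\<dots> < d" using d by simp
    finally show ?thesis .
  qed
  have S1: "x + s *\<^sub>R v + t *\<^sub>R w \<in> S" if "0 \<le> s" "s \<le> h" "0 \<le> t" "t \<le> h" for s t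
    using near[OF that] d3(2) by (simp add: d_def)
  then have S2: "x + s *\<^sub>R w + t *\<^sub>R v \<in> S" if "0 \<le> s" "s \<le> h" "0 \<le> t" "t \<le> h" for s t
    using S1[of t s] that by (simp add: algebra_simps)
  obtain s t where st: "0 < s" "s < h" "0 < t" "t < h"
    "f (x + h *\<^sub>R v + h *\<^sub>R w) - f (x + h *\<^sub>R v) - f (x + h *\<^sub>R w) + f x = h * (h * P (x + s *\<^sub>R v + t *\<^sub>R w))"
    unfolding P_def by (rule second_difference_mean_value[OF f h, of x v w]) (auto intro: S1)
  obtain s' t' where st': "0 < s'" "s' < h" "0 < t'" "t' < h"
    "f (x + h *\<^sub>R w + h *\<^sub>R v) - f (x + h *\<^sub>R w) - f (x + h *\<^sub>R v) + f x = h * (h * Q (x + s' *\<^sub>R w + t' *\<^sub>R v))"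
    unfolding Q_def by (rule second_difference_mean_value[OF f h, of x w v]) (auto intro: S2)
  have "h * (h * P (x + s *\<^sub>R v + t *\<^sub>R w)) = h * (h * Q (x + t' *\<^sub>R v + s' *\<^sub>R w))"
    using st(5) st'(5) by (simp add: algebra_simps)
  then have "P (x + s *\<^sub>R v + t *\<^sub>R w) = Q (x + t' *\<^sub>R v + s' *\<^sub>R w)" using h by simp
  moreover have "dist (P (x + s *\<^sub>R v + t *\<^sub>R w)) (P x) < e"
    using near[of s t] st d1(2) by (simp add: d_def)
  moreover have "dist (Q (x + t' *\<^sub>R v + s' *\<^sub>R w)) (Q x) < e"
    using near[of t' s'] st' d2(2) by (simp add: d_def)
  ultimately show False unfolding e_def dist_real_def by (auto simp: abs_if split: if_splits)
qed

lemma D_inner_left: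
  assumes "smooth_on S f" "x \<in> S"
  shows "D (\<lambda>y. f y \<bullet> c) x v = D f x v \<bullet> c"
  by (rule D_eqI, rule has_derivative_inner_left, rule smooth_on_has_derivative[OF assms])

lemma D_cong:
  assumes "open S" "x \<in> S" "\<And>y. y \<in> S \<Longrightarrow> f y = g y"
  shows "D f x = D g x"
proof -
  have "(f has_derivative f') (at x) \<longleftrightarrow> (g has_derivative f') (at x)" for f'
    using has_derivative_transform_within_open[OF _ assms(1,2)] assms(3) by metis
  then show ?thesis unfolding frechet_derivative_def by simp
qed

lemma second_derivative_symmetric:
  fixes f :: "'a::real_normed_vector \<Rightarrow> 'b::euclidean_space"
  assumes S: "open S" and f: "smooth_on S f" and x: "x \<in> S"
  shows "D (\<lambda>y. D f y v) x w = D (\<lambda>y. D f y w) x v"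
proof (rule euclidean_eqI)
  fix c :: 'b
  have fc: "smooth_on S (\<lambda>y. f y \<bullet> c)"
    by (rule smooth_on_bounded_linear[OF S f bounded_linear_inner_left])
  have *: "D (\<lambda>y. D f y v) x w \<bullet> c = D (\<lambda>y. D (\<lambda>y. f y \<bullet> c) y v) x w" for v w
    unfolding D_inner_left[OF smooth_on_D[OF f] x, symmetric]
    by (rule fun_cong[OF D_cong[OF S x]]) (simp add: D_inner_left[OF f])
  show "D (\<lambda>y. D f y v) x w \<bullet> c = D (\<lambda>y. D f y w) x v \<bullet> c"
    unfolding * by (rule second_derivative_symmetric_real[OF S fc x])
qed

section \<open>Product rules for tensor fields along maps\<close>

text \<open>Expansion of \<open>X\<close> in a basis reduces this to the product rule for functions. With \<open>\<gamma>\<close> the identity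
  it differentiates a form applied to a vector field, with \<open>\<gamma>\<close> a curve it serves for flows.\<close>

lemma one_form_product_rule:
  fixes \<alpha> :: "'e::euclidean_space \<Rightarrow> 'f::euclidean_space \<Rightarrow> real"
  assumes S: "open S" "\<gamma> t \<in> S" and lin: "\<And>y. y \<in> S \<Longrightarrow> linear (\<alpha> y)"
    and diff: "\<And>v. (\<lambda>y. \<alpha> y v) differentiable (at (\<gamma> t))"
    and \<gamma>: "(\<gamma> has_derivative \<gamma>') (at t)" and X: "(X has_derivative X') (at t)"
  shows "((\<lambda>s. \<alpha> (\<gamma> s) (X s)) has_derivative
    (\<lambda>h. D (\<lambda>y. \<alpha> y (X t)) (\<gamma> t) (\<gamma>' h) + \<alpha> (\<gamma> t) (X' h))) (at t)"
proof -
  have expand: "\<alpha> y v = (\<Sum>p\<in>Basis. (v \<bullet> p) * \<alpha> y p)" if "y \<in> S" for y v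
    using linear_sum[OF lin[OF that], of "\<lambda>p. (v \<bullet> p) *\<^sub>R p" Basis]
    by (simp add: euclidean_representation linear_cmul[OF lin[OF that]])
  have Dp: "((\<lambda>y. \<alpha> y p) has_derivative D (\<lambda>y. \<alpha> y p) (\<gamma> t)) (at (\<gamma> t))" for p
    using diff by (simp add: frechet_derivative_works)
  have "((\<lambda>y. \<Sum>p\<in>Basis. (v \<bullet> p) * \<alpha> y p) has_derivative
      (\<lambda>k. \<Sum>p\<in>Basis. (v \<bullet> p) * D (\<lambda>y. \<alpha> y p) (\<gamma> t) k)) (at (\<gamma> t))" for v
    by (intro has_derivative_sum has_derivative_mult_right Dp)
  note Dsum = this
  have Dv: "D (\<lambda>y. \<alpha> y v) (\<gamma> t) k = (\<Sum>p\<in>Basis. (v \<bullet> p) * D (\<lambda>y. \<alpha> y p) (\<gamma> t) k)" for v k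
    by (rule D_eqI, rule has_derivative_transform_within_open[OF Dsum S]) (simp add: expand[symmetric])
  have \<gamma>p: "((\<lambda>s. \<alpha> (\<gamma> s) p) has_derivative (\<lambda>h. D (\<lambda>y. \<alpha> y p) (\<gamma> t) (\<gamma>' h))) (at t)" for p
    by (rule has_derivative_compose[OF \<gamma> Dp])
  have "((\<lambda>s. \<Sum>p\<in>Basis. (X s \<bullet> p) * \<alpha> (\<gamma> s) p) has_derivative
      (\<lambda>h. \<Sum>p\<in>Basis. (X t \<bullet> p) * D (\<lambda>y. \<alpha> y p) (\<gamma> t) (\<gamma>' h) + (X' h \<bullet> p) * \<alpha> (\<gamma> t) p)) (at t)"
    by (intro has_derivative_sum has_derivative_mult \<gamma>p has_derivative_inner_left X)
  moreover have "(\<lambda>h. \<Sum>p\<in>Basis. (X t \<bullet> p) * D (\<lambda>y. \<alpha> y p) (\<gamma> t) (\<gamma>' h) + (X' h \<bullet> p) * \<alpha> (\<gamma> t) p) =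
      (\<lambda>h. D (\<lambda>y. \<alpha> y (X t)) (\<gamma> t) (\<gamma>' h) + \<alpha> (\<gamma> t) (X' h))"
    unfolding Dv[of "X t"] by (simp add: sum.distrib expand[OF S(2), symmetric])
  ultimately have *: "((\<lambda>s. \<Sum>p\<in>Basis. (X s \<bullet> p) * \<alpha> (\<gamma> s) p) has_derivative
      (\<lambda>h. D (\<lambda>y. \<alpha> y (X t)) (\<gamma> t) (\<gamma>' h) + \<alpha> (\<gamma> t) (X' h))) (at t)" by simp
  have "isCont \<gamma> t" using \<gamma> has_derivative_continuous by blast
  then have "\<forall>\<^sub>F s in at t. \<gamma> s \<in> S"
    using S by (metis continuous_at topological_tendstoD)
  then have "\<forall>\<^sub>F s in at t. (\<Sum>p\<in>Basis. (X s \<bullet> p) * \<alpha> (\<gamma> s) p) = \<alpha> (\<gamma> s) (X s)"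
    by eventually_elim (simp add: expand[symmetric])
  then show ?thesis
    by (rule has_derivative_transform_eventually[OF *]) (simp_all add: expand[OF S(2), symmetric])
qed

lemma two_tensor_product_rule:
  fixes \<beta> :: "'e::euclidean_space \<Rightarrow> 'f::euclidean_space \<Rightarrow> 'g::euclidean_space \<Rightarrow> real"
  assumes S: "open S" "\<gamma> t \<in> S" and lin: "\<And>y. y \<in> S \<Longrightarrow> bilinear (\<beta> y)"
    and diff: "\<And>v w. (\<lambda>y. \<beta> y v w) differentiable (at (\<gamma> t))"
    and \<gamma>: "(\<gamma> has_derivative \<gamma>') (at t)"
    and X: "(X has_derivative X') (at t)" and Y: "(Y has_derivative Y') (at t)"
  shows "((\<lambda>s. \<beta> (\<gamma> s) (X s) (Y s)) has_derivative
    (\<lambda>h. D (\<lambda>y. \<beta> y (X t) (Y t)) (\<gamma> t) (\<gamma>' h) + \<beta> (\<gamma> t) (X' h) (Y t) + \<beta> (\<gamma> t) (X t) (Y' h))) (at t)"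
proof -
  \<comment> \<open>Freezing the first argument leaves a 1-form in the second; the pair of base point and second
    argument can then serve as the base point of a 1-form in the first.\<close>
  have fst: "((\<lambda>p. \<beta> (fst p) v (snd p)) has_derivative
      (\<lambda>h. D (\<lambda>y. \<beta> y v (Y t)) (\<gamma> t) (fst h) + \<beta> (\<gamma> t) v (snd h))) (at (\<gamma> t, Y t))" for v
    using one_form_product_rule[of S fst "(\<gamma> t, Y t)" "\<lambda>y. \<beta> y v" fst snd snd] S lin diff
    by (simp add: bilinear_def has_derivative_fst[OF has_derivative_ident]
        has_derivative_snd[OF has_derivative_ident])
  have "((\<lambda>s. \<beta> (fst (\<gamma> s, Y s)) (X s) (snd (\<gamma> s, Y s))) has_derivative
      (\<lambda>h. D (\<lambda>p. \<beta> (fst p) (X t) (snd p)) (\<gamma> t, Y t) (\<gamma>' h, Y' h) + \<beta> (fst (\<gamma> t, Y t)) (X' h) (snd (\<gamma> t, Y t)))) (at t)"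
  proof (rule one_form_product_rule[of "S \<times> UNIV" "\<lambda>s. (\<gamma> s, Y s)" t "\<lambda>p v. \<beta> (fst p) v (snd p)"])
    show "linear (\<lambda>v. \<beta> (fst p) v (snd p))" if "p \<in> S \<times> UNIV" for p
      using lin that by (auto simp: bilinear_def)
    show "(\<lambda>p. \<beta> (fst p) v (snd p)) differentiable (at (\<gamma> t, Y t))" for v
      using fst by (rule differentiableI)
  qed (use S X in \<open>auto intro: open_Times has_derivative_Pair \<gamma> Y\<close>)
  then show ?thesis
    by (simp add: D_eqI[OF fst] add_ac)
qed

section \<open>The Reeb field of a standard pseudo-Hermitian structure is Killing\<close>

text \<open>The Lie derivative \<open>L\<^sub>A \<beta>\<close>, evaluated on constant fields, for which \<open>[A, v] = - DA(v)\<close>.\<close>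

definition lie_bilinear :: "('e::euclidean_space \<Rightarrow> 'e) \<Rightarrow> ('e \<Rightarrow> 'e \<Rightarrow> 'e \<Rightarrow> real) \<Rightarrow> 'e \<Rightarrow> 'e \<Rightarrow> 'e \<Rightarrow> real" where
  "lie_bilinear A \<beta> x v w = D (\<lambda>y. \<beta> y v w) x (A x) + \<beta> x (D A x v) w + \<beta> x v (D A x w)"

lemma lie_bilinear_bilinear:
  assumes S: "open S" "x \<in> S" and lin: "\<And>y. y \<in> S \<Longrightarrow> bilinear (\<beta> y)"
    and sm: "\<And>v w. smooth_on S (\<lambda>y. \<beta> y v w)" and A: "smooth_on S A"
  shows "bilinear (lie_bilinear A \<beta> x)"
proof -
  note d = smooth_on_has_derivative[OF sm S(2)]
  have 1: "D (\<lambda>y. \<beta> y (u + v) w) x h = D (\<lambda>y. \<beta> y u w) x h + D (\<lambda>y. \<beta> y v w) x h"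
    "D (\<lambda>y. \<beta> y w (u + v)) x h = D (\<lambda>y. \<beta> y w u) x h + D (\<lambda>y. \<beta> y w v) x h" for u v w h
    using D_eqI[OF has_derivative_add[OF d d]]
    by (simp_all add: D_cong[OF S bilinear_ladd[OF lin]] D_cong[OF S bilinear_radd[OF lin]])
  have 2: "D (\<lambda>y. \<beta> y (r *\<^sub>R v) w) x h = r * D (\<lambda>y. \<beta> y v w) x h"
    "D (\<lambda>y. \<beta> y w (r *\<^sub>R v)) x h = r * D (\<lambda>y. \<beta> y w v) x h" for r v w h
    using D_eqI[OF has_derivative_mult_right[OF d]]
    by (simp_all add: D_cong[OF S bilinear_lmul[OF lin]] D_cong[OF S bilinear_rmul[OF lin]])
  note L = D_linear[OF A S(2)] and B = lin[OF S(2)]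
  show ?thesis
    unfolding bilinear_def lie_bilinear_def
    by (intro conjI allI linearI)
      (simp_all add: 1 2 linear_add[OF L] linear_cmul[OF L] bilinear_ladd[OF B] bilinear_radd[OF B]
        bilinear_lmul[OF B] bilinear_rmul[OF B] distrib_left)
qed

lemma smooth_on_diff:
  fixes f g :: "'a::real_normed_vector \<Rightarrow> real"
  assumes "open S" "smooth_on S f" "smooth_on S g"
  shows "smooth_on S (\<lambda>x. f x - g x)"
proof -
  have "smooth_on S (\<lambda>x. - g x)"
    by (rule smooth_on_bounded_linear[OF assms(1,3)]) (rule bounded_linear_minus[OF bounded_linear_ident])
  then have "smooth_on S (\<lambda>x. f x + - g x)"
    using assms(2) Ck_on_add[OF assms(1)] unfolding smooth_on_def by blast
  then show ?thesis by simp
qed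

lemma ext_deriv_smooth:
  assumes "open S" "one_form_on S \<eta>"
  shows "smooth_on S (\<lambda>x. ext_deriv \<eta> x v w)"
  unfolding ext_deriv_def using assms by (intro smooth_on_diff smooth_on_D) (auto simp: one_form_on_def)

lemma ext_deriv_swap: "ext_deriv \<eta> x v w = - ext_deriv \<eta> x w v"
  by (simp add: ext_deriv_def)

lemma ext_deriv_bilinear:
  assumes S: "open S" "x \<in> S" and \<eta>: "one_form_on S \<eta>"
  shows "bilinear (ext_deriv \<eta> x)"
proof -
  have sm: "smooth_on S (\<lambda>y. \<eta> y v)" and lin: "y \<in> S \<Longrightarrow> linear (\<eta> y)" for v y
    using \<eta> by (auto simp: one_form_on_def)
  note d = smooth_on_has_derivative[OF sm S(2)]
  have 1: "D (\<lambda>y. \<eta> y (u + v)) x h = D (\<lambda>y. \<eta> y u) x h + D (\<lambda>y. \<eta> y v) x h" for u v h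
    using D_eqI[OF has_derivative_add[OF d d]] by (simp add: D_cong[OF S linear_add[OF lin]])
  have 2: "D (\<lambda>y. \<eta> y (r *\<^sub>R v)) x h = r * D (\<lambda>y. \<eta> y v) x h" for r v h
    using D_eqI[OF has_derivative_mult_right[OF d]] by (simp add: D_cong[OF S linear_cmul[OF lin]])
  note L = D_linear[OF sm S(2)]
  show ?thesis
    unfolding bilinear_def ext_deriv_def
    by (intro conjI allI linearI)
      (simp_all add: 1 2 linear_add[OF L] linear_cmul[OF L] right_diff_distrib)
qed

text \<open>\<open>d(d\<eta>) = 0\<close>: the six second derivatives cancel in pairs.\<close>

lemma ext_deriv_closed:
  assumes S: "open S" "x \<in> S" and \<eta>: "one_form_on S \<eta>"
  shows "D (\<lambda>y. ext_deriv \<eta> y v w) x u + D (\<lambda>y. ext_deriv \<eta> y w u) x v + D (\<lambda>y. ext_deriv \<eta> y u v) x w = 0"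
proof -
  have sm: "smooth_on S (\<lambda>y. \<eta> y v)" for v
    using \<eta> by (auto simp: one_form_on_def)
  note d = smooth_on_has_derivative[OF smooth_on_D[OF sm] S(2)]
  have *: "D (\<lambda>y. ext_deriv \<eta> y v w) x u = D (\<lambda>y. D (\<lambda>z. \<eta> z w) y v) x u - D (\<lambda>y. D (\<lambda>z. \<eta> z v) y w) x u" for u v w
    unfolding ext_deriv_def by (rule D_eqI[OF has_derivative_diff[OF d d]])
  note sd = second_derivative_symmetric[OF S(1) sm S(2)]
  show ?thesis
    unfolding * using sd[of w v u] sd[of v w u] sd[of u w v] by linarith
qed

text \<open>Cartan's formula \<open>L\<^sub>A d\<eta> = \<iota>\<^sub>A d(d\<eta>) + d(\<iota>\<^sub>A d\<eta>)\<close>, in which both terms vanish.\<close>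

lemma lie_bilinear_ext_deriv_reeb:
  assumes S: "open S" "x \<in> S" and \<eta>: "one_form_on S \<eta>" and A: "reeb_on S \<eta> A"
  shows "lie_bilinear A (ext_deriv \<eta>) x v w = 0"
proof -
  have smA: "smooth_on S A" and ker: "y \<in> S \<Longrightarrow> ext_deriv \<eta> y (A y) w = 0" for y w
    using A by (auto simp: reeb_on_def)
  have "((\<lambda>y. ext_deriv \<eta> y (A y) w) has_derivative
      (\<lambda>h. D (\<lambda>y. ext_deriv \<eta> y (A x) w) x h + ext_deriv \<eta> x (D A x h) w + ext_deriv \<eta> x (A x) 0)) (at x)" for w
    using S by (intro two_tensor_product_rule[of S "\<lambda>y. y"] smooth_on_has_derivative[OF smA]
      ext_deriv_bilinear[OF S(1) _ \<eta>] differentiableI[OF smooth_on_has_derivative[OF ext_deriv_smooth[OF S(1) \<eta>]]]) auto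
  then have "D (\<lambda>y. ext_deriv \<eta> y (A y) w) x h =
      D (\<lambda>y. ext_deriv \<eta> y (A x) w) x h + ext_deriv \<eta> x (D A x h) w + ext_deriv \<eta> x (A x) 0" for w h
    by (rule D_eqI)
  moreover have "D (\<lambda>y. ext_deriv \<eta> y (A y) w) x h = D (\<lambda>y. 0) x h" for w h
    by (rule fun_cong[OF D_cong[OF S]]) (rule ker)
  \<comment> \<open>The derivative of \<open>\<iota>\<^sub>A d\<eta> = 0\<close> in the direction \<open>h\<close>.\<close>
  ultimately have z: "D (\<lambda>y. ext_deriv \<eta> y (A x) w) x h + ext_deriv \<eta> x (D A x h) w = 0" for w h
    using ker[OF S(2)] by simp
  have "D (\<lambda>y. ext_deriv \<eta> y w (A x)) x v = - D (\<lambda>y. ext_deriv \<eta> y (A x) w) x v"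
    using D_eqI[OF has_derivative_minus[OF smooth_on_has_derivative[OF ext_deriv_smooth[OF S(1) \<eta>] S(2)]]]
    by (subst ext_deriv_swap) simp
  then show ?thesis
    using ext_deriv_closed[OF S \<eta>, of v w "A x"] z[of w v] z[of v w] ext_deriv_swap[of \<eta> x v "D A x w"]
    unfolding lie_bilinear_def by linarith
qed

text \<open>The variation of the derivative of the flow: its time derivative at 0 is \<open>DA\<close>, by the symmetry of
  the mixed derivative of \<open>(t, x) \<mapsto> \<Phi> t x\<close> in the time and the space directions.\<close>

lemma local_flow_variation:
  assumes flow: "local_flow_on S A V \<epsilon> \<Phi>" and x: "x \<in> V"
    and A: "smooth_on S A"
  shows "((\<lambda>t. D (\<Phi> t) x v) has_vector_derivative D A x v) (at 0)"
    and "D (\<Phi> 0) x v = v"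
proof -
  define F where "F = (\<lambda>(t, x). \<Phi> t x)"
  define I where "I = {-\<epsilon><..<\<epsilon>}"
  have V: "open V" "V \<subseteq> S" "\<epsilon> > 0" and F: "smooth_on (I \<times> V) F"
    and \<Phi>0: "\<And>y. y \<in> V \<Longrightarrow> \<Phi> 0 y = y"
    and \<Phi>: "\<And>y t. y \<in> V \<Longrightarrow> t \<in> I \<Longrightarrow> ((\<lambda>s. \<Phi> s y) has_vector_derivative A (\<Phi> t y)) (at t)"
    using flow by (auto simp: local_flow_on_def F_def I_def)
  have I: "open I" "0 \<in> I" using V by (auto simp: I_def)
  have IV: "open (I \<times> V)" using I V by (simp add: open_Times)
  have D2: "D (\<Phi> t) y v = D F (t, y) (0, v)" if "t \<in> I" "y \<in> V" for t y v
  proof -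
    have "((\<lambda>z. (t, z)) has_derivative (\<lambda>v. (0, v))) (at y)"
      by (auto intro!: derivative_eq_intros)
    moreover have "(F has_derivative D F (t, y)) (at (t, y))"
      using smooth_on_has_derivative[OF F] that by simp
    ultimately have "((\<lambda>z. F (t, z)) has_derivative (\<lambda>v. D F (t, y) (0, v))) (at y)"
      by (rule has_derivative_compose)
    then show ?thesis using D_eqI by (fastforce simp: F_def)
  qed
  have D1: "D F (t, y) (1, 0) = A (\<Phi> t y)" if "t \<in> I" "y \<in> V" for t y
  proof -
    have "((\<lambda>s. (s, y)) has_derivative (\<lambda>h. (h, 0))) (at t)"
      by (auto intro!: derivative_eq_intros)
    moreover have "(F has_derivative D F (t, y)) (at (t, y))"
      using smooth_on_has_derivative[OF F] that by simp
    ultimately have "((\<lambda>s. F (s, y)) has_derivative (\<lambda>h. D F (t, y) (h, 0))) (at t)"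
      by (rule has_derivative_compose)
    moreover have "((\<lambda>s. F (s, y)) has_derivative (\<lambda>h. h *\<^sub>R A (\<Phi> t y))) (at t)"
      using \<Phi>[OF that(2,1)] by (simp add: F_def has_vector_derivative_def)
    ultimately have "(\<lambda>h. D F (t, y) (h, 0)) = (\<lambda>h. h *\<^sub>R A (\<Phi> t y))"
      by (rule has_derivative_unique)
    then show ?thesis by (metis scaleR_one)
  qed
  have "D (\<lambda>p. D F p (1, 0)) (0, x) (0, v) = D A x v"
  proof -
    have "((\<lambda>z. (0::real, z)) has_derivative (\<lambda>v. (0, v))) (at x)"
      by (auto intro!: derivative_eq_intros)
    moreover have "((\<lambda>p. D F p (1, 0)) has_derivative D (\<lambda>p. D F p (1, 0)) (0, x)) (at (0, x))"
      using smooth_on_has_derivative[OF smooth_on_D[OF F]] I x by simp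
    ultimately have "((\<lambda>z. D F (0, z) (1, 0)) has_derivative (\<lambda>v. D (\<lambda>p. D F p (1, 0)) (0, x) (0, v))) (at x)"
      by (rule has_derivative_compose)
    then have "D (\<lambda>z. D F (0, z) (1, 0)) x v = D (\<lambda>p. D F p (1, 0)) (0, x) (0, v)"
      by (rule D_eqI)
    moreover have "D (\<lambda>z. D F (0, z) (1, 0)) x = D A x"
      by (rule D_cong[OF V(1) x]) (simp add: D1 I \<Phi>0)
    ultimately show ?thesis by simp
  qed
  then have sym: "D (\<lambda>p. D F p (0, v)) (0, x) (1, 0) = D A x v"
    using second_derivative_symmetric[OF IV F, of "(0, x)" "(0, v)" "(1, 0)"] I x by simp
  have d: "((\<lambda>p. D F p (0, v)) has_derivative D (\<lambda>p. D F p (0, v)) (0, x)) (at (0, x))"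
    using smooth_on_has_derivative[OF smooth_on_D[OF F]] I x by simp
  have "((\<lambda>s. (s, x)) has_derivative (\<lambda>h. (h, 0))) (at (0::real))"
    by (auto intro!: derivative_eq_intros)
  from has_derivative_compose[OF this d]
  have "((\<lambda>s. D F (s, x) (0, v)) has_derivative (\<lambda>h. D (\<lambda>p. D F p (0, v)) (0, x) (h, 0))) (at 0)" .
  moreover have "(\<lambda>h. D (\<lambda>p. D F p (0, v)) (0, x) (h, 0)) = (\<lambda>h. h *\<^sub>R D A x v)"
    using linear_cmul[OF has_derivative_linear[OF d], of _ "(1, 0)"] sym by auto
  ultimately have "((\<lambda>s. D F (s, x) (0, v)) has_derivative (\<lambda>h. h *\<^sub>R D A x v)) (at 0)" by simp
  then show "((\<lambda>t. D (\<Phi> t) x v) has_vector_derivative D A x v) (at 0)"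
    unfolding has_vector_derivative_def
    by (rule has_derivative_transform_within_open[OF _ I]) (simp add: D2 x)
  have "D (\<Phi> 0) x = D (\<lambda>y. y) x" by (rule D_cong[OF V(1) x \<Phi>0])
  then show "D (\<Phi> 0) x v = v" by simp
qed

text \<open>Since \<open>L\<^sub>A A = 0\<close> and \<open>g(A, \<cdot>) = \<eta>\<close>, this is \<open>(L\<^sub>A \<eta>)(w)\<close>, which vanishes by Cartan's formula:
  \<open>\<iota>\<^sub>A d\<eta> = 0\<close> and \<open>\<eta>(A) = 1\<close>.\<close>

lemma lie_bilinear_reeb_reeb:
  assumes S: "open S" "x \<in> S" and \<eta>: "one_form_on S \<eta>" and A: "reeb_on S \<eta> A"
    and lin: "\<And>y. y \<in> S \<Longrightarrow> bilinear (g y)" and sm: "\<And>v w. smooth_on S (\<lambda>y. g y v w)"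
    and g: "\<And>y w. y \<in> S \<Longrightarrow> g y (A y) w = \<eta> y w"
  shows "lie_bilinear A g x (A x) w = 0"
proof -
  have smA: "smooth_on S A" and one: "y \<in> S \<Longrightarrow> \<eta> y (A y) = 1" and ker: "ext_deriv \<eta> x (A x) w = 0" for y w
    using A S by (auto simp: reeb_on_def)
  have sm\<eta>: "smooth_on S (\<lambda>y. \<eta> y v)" and lin\<eta>: "y \<in> S \<Longrightarrow> linear (\<eta> y)" for v y
    using \<eta> by (auto simp: one_form_on_def)
  have "((\<lambda>y. g y (A y) w) has_derivative
      (\<lambda>h. D (\<lambda>y. g y (A x) w) x h + g x (D A x h) w + g x (A x) 0)) (at x)"
    using S by (intro two_tensor_product_rule[of S "\<lambda>y. y"] smooth_on_has_derivative[OF smA]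
      lin differentiableI[OF smooth_on_has_derivative[OF sm]]) auto
  then have "D (\<lambda>y. g y (A y) w) x (A x) = D (\<lambda>y. g y (A x) w) x (A x) + g x (D A x (A x)) w + g x (A x) 0"
    by (rule D_eqI)
  moreover have "D (\<lambda>y. g y (A y) w) x = D (\<lambda>y. \<eta> y w) x" by (rule D_cong[OF S g])
  moreover have "((\<lambda>y. \<eta> y (A y)) has_derivative (\<lambda>h. D (\<lambda>y. \<eta> y (A x)) x h + \<eta> x (D A x h))) (at x)"
    using S by (intro one_form_product_rule[of S "\<lambda>y. y"] smooth_on_has_derivative[OF smA]
      lin\<eta> differentiableI[OF smooth_on_has_derivative[OF sm\<eta>]]) auto
  then have "D (\<lambda>y. \<eta> y (A y)) x w = D (\<lambda>y. \<eta> y (A x)) x w + \<eta> x (D A x w)"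
    by (rule D_eqI)
  moreover have "D (\<lambda>y. \<eta> y (A y)) x = D (\<lambda>y. 1) x" by (rule D_cong[OF S one])
  ultimately show ?thesis
    using ker[of w] g[OF S(2)] linear_0[OF lin\<eta>[OF S(2)]]
    by (simp add: lie_bilinear_def ext_deriv_def)
qed

text \<open>On \<open>ker \<eta>\<close> one has \<open>g(v, w) = d\<eta>(v, J w)\<close>. The flow maps commute with \<open>J\<close> there, so that
  \<open>g(D\<Phi> v, D\<Phi> w) = d\<eta>(D\<Phi> v, D\<Phi> (J w))\<close>, an equation without derivatives of \<open>J\<close>. Differentiating it
  at time 0 gives \<open>(L\<^sub>A g)(v, w) = (L\<^sub>A d\<eta>)(v, J w) = 0\<close>. The direction of \<open>A\<close> is treated separately.\<close>

lemma reeb_field_killing: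
  fixes g :: "'e::euclidean_space \<Rightarrow> 'e \<Rightarrow> 'e \<Rightarrow> real"
  assumes S: "open S" "x \<in> S" and \<eta>: "one_form_on S \<eta>" and A: "reeb_on S \<eta> A"
    and J: "complex_structure_on S \<eta> J" and flow: "flow_preserves_on S A \<eta> J"
    and lin: "\<And>y. y \<in> S \<Longrightarrow> bilinear (g y)" and sm: "\<And>v w. smooth_on S (\<lambda>y. g y v w)"
    and sym: "\<And>y v w. g y v w = g y w v"
    and g: "\<And>y v w. y \<in> S \<Longrightarrow> g y v w = sasaki_metric \<eta> J A y v w"
  shows "lie_bilinear A g x v w = 0"
proof -
  have smA: "smooth_on S A" and one: "y \<in> S \<Longrightarrow> \<eta> y (A y) = 1" for y
    using A by (auto simp: reeb_on_def)
  have lin\<eta>: "y \<in> S \<Longrightarrow> linear (\<eta> y)" for y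
    using \<eta> by (auto simp: one_form_on_def)
  have reeb: "lie_bilinear A g x (A x) w = 0" for w
  proof (rule lie_bilinear_reeb_reeb[OF S \<eta> A lin sm])
    fix y w assume "y \<in> S"
    then show "g y (A y) w = \<eta> y w"
      by (simp add: g sasaki_metric_def one bilinear_lzero[OF ext_deriv_bilinear[OF S(1) _ \<eta>]])
  qed
  have horiz: "lie_bilinear A g x v w = 0" if vw: "\<eta> x v = 0" "\<eta> x w = 0" for v w
  proof -
    obtain V \<epsilon> \<Phi> where x: "x \<in> V" and fl: "local_flow_on S A V \<epsilon> \<Phi>"
      and pres: "\<And>t v. t \<in> {-\<epsilon><..<\<epsilon>} \<Longrightarrow> \<eta> x v = 0 \<Longrightarrow>
        \<eta> (\<Phi> t x) (D (\<Phi> t) x v) = 0 \<and> J (\<Phi> t x) (D (\<Phi> t) x v) = D (\<Phi> t) x (J x v)"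
      using flow S(2) unfolding flow_preserves_on_def Let_def by (metis (no_types, lifting))
    have eps: "\<epsilon> > 0" and \<Phi>S: "t \<in> {-\<epsilon><..<\<epsilon>} \<Longrightarrow> \<Phi> t x \<in> S" and \<Phi>0: "\<Phi> 0 x = x"
      and all: "\<forall>t\<in>{-\<epsilon><..<\<epsilon>}. ((\<lambda>s. \<Phi> s x) has_vector_derivative A (\<Phi> t x)) (at t)" for t
      using fl x by (auto simp: local_flow_on_def)
    have \<Phi>d: "((\<lambda>s. \<Phi> s x) has_vector_derivative A x) (at 0)"
      using bspec[OF all, of 0] eps by (simp add: \<Phi>0)
    have u: "\<eta> x (J x w) = 0" using J S(2) vw unfolding complex_structure_on_def by blast
    define u where "u = J x w"
    \<comment> \<open>Both sides make sense along the whole orbit, and \<open>J\<close> enters only through the fixed vector \<open>J x w\<close>.\<close>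
    have eq: "g (\<Phi> t x) (D (\<Phi> t) x v) (D (\<Phi> t) x w) = ext_deriv \<eta> (\<Phi> t x) (D (\<Phi> t) x v) (D (\<Phi> t) x u)"
      if "t \<in> {-\<epsilon><..<\<epsilon>}" for t
      using pres[OF that vw(1)] pres[OF that vw(2)]
      by (simp add: g[OF \<Phi>S[OF that]] sasaki_metric_def u_def)
    have rule: "((\<lambda>t. \<beta> (\<Phi> t x) (D (\<Phi> t) x v) (D (\<Phi> t) x w)) has_derivative
        (\<lambda>h. D (\<lambda>y. \<beta> y (D (\<Phi> 0) x v) (D (\<Phi> 0) x w)) (\<Phi> 0 x) (h *\<^sub>R A x) +
          \<beta> (\<Phi> 0 x) (h *\<^sub>R D A x v) (D (\<Phi> 0) x w) + \<beta> (\<Phi> 0 x) (D (\<Phi> 0) x v) (h *\<^sub>R D A x w))) (at 0)"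
      if "\<And>y. y \<in> S \<Longrightarrow> bilinear (\<beta> y)" and "\<And>v w. smooth_on S (\<lambda>y. \<beta> y v w)"
      for v w and \<beta> :: "'e \<Rightarrow> 'e \<Rightarrow> 'e \<Rightarrow> real"
      using S(2) \<Phi>d local_flow_variation(1)[OF fl x smA]
      by (intro two_tensor_product_rule[of S "\<lambda>t. \<Phi> t x" 0 \<beta> _ "\<lambda>t. D (\<Phi> t) x v" _ "\<lambda>t. D (\<Phi> t) x w"]
          that(1) S(1) differentiableI[OF smooth_on_has_derivative[OF that(2)]])
        (simp_all add: \<Phi>0 has_vector_derivative_def)
    have "((\<lambda>t. g (\<Phi> t x) (D (\<Phi> t) x v) (D (\<Phi> t) x w)) has_derivative
        (\<lambda>h. D (\<lambda>y. ext_deriv \<eta> y (D (\<Phi> 0) x v) (D (\<Phi> 0) x u)) (\<Phi> 0 x) (h *\<^sub>R A x) +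
          ext_deriv \<eta> (\<Phi> 0 x) (h *\<^sub>R D A x v) (D (\<Phi> 0) x u) + ext_deriv \<eta> (\<Phi> 0 x) (D (\<Phi> 0) x v) (h *\<^sub>R D A x u))) (at 0)"
      by (rule has_derivative_transform_within_open[OF
            rule[OF ext_deriv_bilinear[OF S(1) _ \<eta>] ext_deriv_smooth[OF S(1) \<eta>]], of "{-\<epsilon><..<\<epsilon>}"])
        (use eps eq in auto)
    from fun_cong[OF has_derivative_unique[OF rule[OF lin sm] this], of 1]
    have "lie_bilinear A g x v w = lie_bilinear A (ext_deriv \<eta>) x v u"
      by (simp add: lie_bilinear_def \<Phi>0 local_flow_variation(2)[OF fl x smA])
    then show ?thesis by (simp add: lie_bilinear_ext_deriv_reeb[OF S \<eta> A])
  qed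
  note B = lie_bilinear_bilinear[OF S lin sm smA]
  have symL: "lie_bilinear A g x v w = lie_bilinear A g x w v" for v w
    by (simp add: lie_bilinear_def sym[of _ w v] sym[of _ "D A x v"] sym[of _ _ "D A x w"])
  have ker: "\<eta> x (v - \<eta> x v *\<^sub>R A x) = 0" for v
    by (simp add: linear_diff[OF lin\<eta>[OF S(2)]] linear_cmul[OF lin\<eta>[OF S(2)]] one[OF S(2)])
  have "lie_bilinear A g x v w = lie_bilinear A g x (v - \<eta> x v *\<^sub>R A x) w"
    by (simp add: bilinear_lsub[OF B] bilinear_lmul[OF B] reeb)
  also have "\<dots> = lie_bilinear A g x (v - \<eta> x v *\<^sub>R A x) (w - \<eta> x w *\<^sub>R A x)"
    by (simp add: bilinear_rsub[OF B] bilinear_rmul[OF B] symL[of _ "A x"] reeb)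
  also have "\<dots> = 0" by (rule horiz[OF ker ker])
  finally show ?thesis .
qed

section \<open>The structure tensor\<close>

text \<open>The endomorphism is \<open>\<phi> w = - J (w - \<eta>(w) A)\<close>. The second property expresses that \<open>\<phi>\<close> is the
  projection to \<open>ker \<eta>\<close> followed by an isometry; it determines the norm of \<open>d\<eta>\<close>.\<close>

lemma sasaki_structure_tensor:
  assumes S: "open S" "x \<in> S" and ph: "pseudo_hermitian_on S \<eta> J" and A: "reeb_on S \<eta> A"
    and g: "\<And>v w. g x v w = sasaki_metric \<eta> J A x v w"
  obtains \<phi> where "\<And>v w. ext_deriv \<eta> x v w = g x v (\<phi> w)"
    "\<And>w. g x (\<phi> w) (\<phi> w) = g x w w - (\<eta> x w)\<^sup>2"
proof -
  have J: "complex_structure_on S \<eta> J" and P: "pos_def_hermitian_on S \<eta> J" and \<eta>: "one_form_on S \<eta>"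
    using ph by (auto simp: pseudo_hermitian_on_def contact_on_def)
  have Jx: "\<eta> x (J x v) = 0" "J x (J x v) = - v" "J x (r *\<^sub>R v) = r *\<^sub>R J x v" if "\<eta> x v = 0" for v r
    using J S(2) that unfolding complex_structure_on_def by blast+
  have herm: "ext_deriv \<eta> x (J x v) (J x (J x v)) = ext_deriv \<eta> x v (J x v)" if "\<eta> x v = 0" for v
    using P S(2) that unfolding pos_def_hermitian_on_def Let_def by blast
  have one: "\<eta> x (A x) = 1" and ker: "ext_deriv \<eta> x (A x) w = 0" for w
    using A S(2) by (auto simp: reeb_on_def)
  have L: "linear (\<eta> x)" using \<eta> S(2) by (simp add: one_form_on_def)
  note B = ext_deriv_bilinear[OF S \<eta>]
  define pr where "pr w = w - \<eta> x w *\<^sub>R A x" for w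
  have pr: "\<eta> x (pr w) = 0" for w
    by (simp add: pr_def linear_diff[OF L] linear_cmul[OF L] one)
  have ker': "ext_deriv \<eta> x w (A x) = 0" for w using ker[of w] ext_deriv_swap[of \<eta> x w] by simp
  have epr: "ext_deriv \<eta> x (pr v) (pr w) = ext_deriv \<eta> x v w" for v w
    by (simp add: pr_def bilinear_lsub[OF B] bilinear_rsub[OF B] bilinear_lmul[OF B] bilinear_rmul[OF B] ker ker')
  define \<phi> where "\<phi> w = (-1) *\<^sub>R J x (pr w)" for w
  have \<phi>0: "\<eta> x (\<phi> w) = 0" for w
    unfolding \<phi>_def linear_cmul[OF L] using Jx(1)[OF pr] by simp
  have J\<phi>: "J x (\<phi> w) = pr w" for w
    unfolding \<phi>_def Jx(3)[OF Jx(1)[OF pr]] Jx(2)[OF pr] by simp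
  show ?thesis
  proof
    show "ext_deriv \<eta> x v w = g x v (\<phi> w)" for v w
      using epr[of v w] by (simp add: g sasaki_metric_def \<phi>0 J\<phi> pr_def[of v])
    show "g x (\<phi> w) (\<phi> w) = g x w w - (\<eta> x w)\<^sup>2" for w
    proof -
      have "g x (\<phi> w) (\<phi> w) = ext_deriv \<eta> x (\<phi> w) (pr w)"
        by (simp add: g sasaki_metric_def \<phi>0 J\<phi>)
      also have "\<dots> = ext_deriv \<eta> x (J x (pr w)) (J x (J x (pr w)))"
        unfolding \<phi>_def Jx(2)[OF pr] by (simp add: bilinear_lneg[OF B] bilinear_rneg[OF B])
      also have "\<dots> = ext_deriv \<eta> x (pr w) (J x (pr w))" by (rule herm[OF pr])
      also have "\<dots> = g x w w - (\<eta> x w)\<^sup>2"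
        by (simp add: g sasaki_metric_def pr_def[of w] power2_eq_square)
      finally show ?thesis .
    qed
  qed
qed

section \<open>Left-invariant derivatives on the Heisenberg group\<close>

lemma horizontal_lift_eq: "horizontal_lift x u = (- Im (herm (snd x) u), u)"
  by (cases x) (simp add: horizontal_lift_def)

text \<open>The derivatives along the left-invariant fields \<open>X\<^sub>u\<close> and \<open>T\<close>.\<close>

abbreviation hderiv :: "complex ^ 'n::finite \<Rightarrow> ('n heis \<Rightarrow> real) \<Rightarrow> 'n heis \<Rightarrow> real" where
  "hderiv u f x \<equiv> D f x (horizontal_lift x u)"

abbreviation vderiv :: "('n::finite heis \<Rightarrow> real) \<Rightarrow> 'n heis \<Rightarrow> real" where
  "vderiv f x \<equiv> D f x (1, 0)"

lemma hderiv_has_derivative: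
  assumes S: "open S" "x \<in> S" and f: "smooth_on S f"
  shows "(hderiv u f has_derivative
    (\<lambda>h. D (\<lambda>y. D f y (horizontal_lift x u)) x h - Im (herm (snd h) u) * vderiv f x)) (at x)"
proof -
  have "linear (\<lambda>h :: 'a heis. (Im (herm (snd h) u), 0 :: complex ^ 'a))"
    by (auto intro!: linearI simp: herm_add_left herm_scaleR_left)
  then have bl: "bounded_linear (\<lambda>h :: 'a heis. (Im (herm (snd h) u), 0 :: complex ^ 'a))"
    by (simp add: linear_conv_bounded_linear)
  have "((\<lambda>y. (0, u) - (Im (herm (snd y) u), 0)) has_derivative
      (\<lambda>h. 0 - (Im (herm (snd h) u), 0))) (at x)"
    by (intro has_derivative_diff has_derivative_const bounded_linear_imp_has_derivative bl)
  moreover have "(\<lambda>y. (0, u) - (Im (herm (snd y) u), 0)) = (\<lambda>y. horizontal_lift y u)"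
    by (simp add: fun_eq_iff horizontal_lift_eq)
  ultimately have h: "((\<lambda>y. horizontal_lift y u) has_derivative (\<lambda>h. - (Im (herm (snd h) u), 0))) (at x)"
    by simp
  have "((\<lambda>y. D f y (horizontal_lift y u)) has_derivative
      (\<lambda>h. D (\<lambda>y. D f y (horizontal_lift x u)) x h + D f x (- (Im (herm (snd h) u), 0)))) (at x)"
    using S by (intro one_form_product_rule[of S "\<lambda>y. y"] D_linear[OF f] h
        differentiableI[OF smooth_on_has_derivative[OF smooth_on_D[OF f]]]) auto
  moreover have "D f x (- (r, 0)) = - (r * vderiv f x)" for r
    using linear_cmul[OF D_linear[OF f S(2)], of "- r" "(1, 0)"] by simp
  ultimately show ?thesis by simp
qed

text \<open>\<open>[X\<^sub>v, X\<^sub>u] = - 2 Im \<langle>v, u\<rangle> T\<close>.\<close>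

lemma hderiv_commutator:
  assumes S: "open S" "x \<in> S" and f: "smooth_on S f"
  shows "hderiv v (hderiv u f) x = hderiv u (hderiv v f) x - 2 * Im (herm v u) * vderiv f x"
  unfolding D_eqI[OF hderiv_has_derivative[OF S f]]
  using second_derivative_symmetric[OF S(1) f S(2), of "horizontal_lift x u" "horizontal_lift x v"]
    Im_herm_swap[of u v]
  by (simp add: horizontal_lift_eq)

text \<open>\<open>T\<close> is central.\<close>

lemma hderiv_vderiv:
  assumes S: "open S" "x \<in> S" and f: "smooth_on S f"
  shows "hderiv u (vderiv f) x = vderiv (hderiv u f) x"
  unfolding D_eqI[OF hderiv_has_derivative[OF S f]]
  using second_derivative_symmetric[OF S(1) f S(2)] by simp

lemma Im_herm_linear: "linear (\<lambda>h. Im (herm (snd h) u))" for u :: "complex ^ 'n::finite"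
  by (auto intro!: linearI simp: herm_add_left herm_scaleR_left)

lemma heis_metric_smooth:
  assumes "open U"
  shows "smooth_on U (\<lambda>x :: 'n::finite heis. heis_metric x v w)"
  unfolding smooth_on_def
proof
  fix j
  have "Ck_on j U (\<lambda>x. heis_form x v)" for v :: "'n heis"
  proof -
    have "Ck_on j U (\<lambda>x. Im (herm (snd x) (snd v)) + fst v)"
      by (intro Ck_on_affine) (simp add: Im_herm_linear flip: linear_conv_bounded_linear)
    moreover have "(\<lambda>x. heis_form x v) = (\<lambda>x. Im (herm (snd x) (snd v)) + fst v)"
      by (auto simp: heis_form_def fun_eq_iff split_beta)
    ultimately show ?thesis by simp
  qed
  then show "Ck_on j U (\<lambda>x. heis_metric x v w)"
    unfolding heis_metric_eq by (intro Ck_on_add Ck_on_mult Ck_on_const assms)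
qed

lemma heis_metric_bilinear: "bilinear (heis_metric x)"
  unfolding bilinear_def heis_metric_eq
  by (intro conjI allI linearI)
    (simp_all add: linear_add[OF heis_form_linear] linear_cmul[OF heis_form_linear]
      inner_add_left inner_add_right algebra_simps del: split_paired_All)

lemma heis_form_T [simp]: "heis_form x (1, 0) = 1"
  by (cases x) (simp add: heis_form_def)

lemma heis_form_horizontal [simp]: "heis_form x (horizontal_lift x u) = 0"
  by (cases x) (simp add: heis_form_def horizontal_lift_def)

lemma snd_horizontal [simp]: "snd (horizontal_lift x u) = u"
  by (simp add: horizontal_lift_eq)

text \<open>Parseval's identity for the frame of \<open>T\<close> and the horizontal fields; the factor 1/2 enters because the
  latter have squared length 2.\<close>

lemma heis_metric_frame:
  fixes p :: "'n::finite heis"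
  shows "heis_metric x p p =
    (heis_metric x (1, 0) p)\<^sup>2 + (\<Sum>j\<in>Basis. (heis_metric x (horizontal_lift x j) p)\<^sup>2) / 2"
proof -
  have "(\<Sum>j\<in>Basis. (heis_metric x (horizontal_lift x j) p)\<^sup>2) = 4 * (\<Sum>j\<in>Basis. (snd p \<bullet> j)\<^sup>2)"
    by (simp add: heis_metric_eq power_mult_distrib sum_distrib_left inner_commute)
  then show ?thesis
    by (simp add: heis_metric_eq power2_eq_square euclidean_inner[of "snd p" "snd p"])
qed

section \<open>Sasaki structures on open subsets of the Heisenberg group\<close>

locale heis_sasaki_chart =
  fixes S :: "'n::finite heis set" and \<eta> J A
  assumes S: "open S" and ph: "pseudo_hermitian_on S \<eta> J" and reeb: "reeb_on S \<eta> A"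
    and flow: "flow_preserves_on S A \<eta> J"
    and metric: "\<And>x v w. x \<in> S \<Longrightarrow> heis_metric x v w = sasaki_metric \<eta> J A x v w"
begin

text \<open>\<open>A = a T + X\<^sub>b\<close>. The horizontal part is given by its components, as the left-invariant derivatives act on
  functions; the vector \<open>dB\<close> collects their first derivatives.\<close>

definition a :: "'n heis \<Rightarrow> real" where "a y = heis_form y (A y)"
definition b :: "complex ^ 'n \<Rightarrow> 'n heis \<Rightarrow> real" where "b u y = snd (A y) \<bullet> u"
definition dB :: "'n heis \<Rightarrow> 'n heis \<Rightarrow> complex ^ 'n" where "dB x v = snd (D A x v)"

lemma eta: "one_form_on S \<eta>"
  using ph by (auto simp: pseudo_hermitian_on_def contact_on_def)

lemma J: "complex_structure_on S \<eta> J"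
  using ph by (auto simp: pseudo_hermitian_on_def)

lemma A_smooth: "smooth_on S A"
  using reeb by (auto simp: reeb_on_def)

lemma eta_eq: "y \<in> S \<Longrightarrow> \<eta> y w = a y * heis_form y w + 2 * b (snd w) y"
proof -
  assume y: "y \<in> S"
  have "\<eta> y w = heis_metric y (A y) w"
    using reeb y by (simp add: metric sasaki_metric_def reeb_on_def bilinear_lzero[OF ext_deriv_bilinear[OF S y eta]])
  then show ?thesis by (simp add: heis_metric_eq a_def b_def)
qed

lemma norm_A: "y \<in> S \<Longrightarrow> (a y)\<^sup>2 + 2 * (snd (A y) \<bullet> snd (A y)) = 1"
  using eta_eq[of y "A y"] reeb by (simp add: reeb_on_def a_def b_def power2_eq_square)

lemma a_smooth: "smooth_on S a"
proof -
  have "smooth_on S (\<lambda>y. \<eta> y (1, 0))" using eta by (simp add: one_form_on_def)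
  then show ?thesis
    unfolding smooth_on_def using Ck_on_cong[OF S, of "\<lambda>y. \<eta> y (1, 0)" a]
    by (simp add: eta_eq b_def)
qed

lemma b_smooth: "smooth_on S (b u)"
  unfolding b_def by (rule smooth_on_bounded_linear[OF S A_smooth])
    (intro bounded_linear_inner_left_comp bounded_linear_snd)

lemma D_b: "x \<in> S \<Longrightarrow> D (b u) x v = dB x v \<bullet> u"
  unfolding b_def dB_def
  by (rule D_eqI, intro has_derivative_inner_left has_derivative_snd smooth_on_has_derivative[OF A_smooth])

lemma D_a: "x \<in> S \<Longrightarrow> D a x v = Im (herm (snd v) (snd (A x))) + heis_form x (D A x v)"
proof -
  assume x: "x \<in> S"
  have "((\<lambda>y. heis_form y (A y)) has_derivative
      (\<lambda>h. D (\<lambda>y. heis_form y (A x)) x h + heis_form x (D A x h))) (at x)"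
    using S x by (intro one_form_product_rule[of S "\<lambda>y. y"] heis_form_linear
      smooth_on_has_derivative[OF A_smooth] differentiableI[OF heis_form_has_derivative]) auto
  then show ?thesis
    unfolding a_def[abs_def] by (rule D_eqI[THEN trans]) (simp add: D_eqI[OF heis_form_has_derivative])
qed

lemma D_heis_metric:
  "D (\<lambda>y. heis_metric y v w) x h =
     Im (herm (snd h) (snd v)) * heis_form x w + heis_form x v * Im (herm (snd h) (snd w))"
proof (rule D_eqI[THEN trans])
  show "((\<lambda>y. heis_metric y v w) has_derivative
      (\<lambda>h. heis_form x v * Im (herm (snd h) (snd w)) + Im (herm (snd h) (snd v)) * heis_form x w)) (at x)"
    unfolding heis_metric_eq
    by (rule has_derivative_add_const) (intro has_derivative_mult heis_form_has_derivative)
qed simp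

text \<open>The Killing equation \<open>(L\<^sub>A g\<^sub>0)(v, w) = 0\<close>. The factors \<open>D a v - 2 Im \<langle>v, b\<rangle>\<close> are the values of
  \<open>L\<^sub>A \<omega>\<^sub>0\<close>.\<close>

lemma killing:
  assumes x: "x \<in> S"
  shows "(D a x v - 2 * Im (herm (snd v) (snd (A x)))) * heis_form x w +
    heis_form x v * (D a x w - 2 * Im (herm (snd w) (snd (A x)))) +
    2 * (dB x v \<bullet> snd w) + 2 * (snd v \<bullet> dB x w) = 0"
proof -
  have "lie_bilinear A heis_metric x v w = 0"
    using heis_metric_smooth[OF S] metric
    by (intro reeb_field_killing[OF S x eta reeb J flow heis_metric_bilinear])
      (auto simp: heis_metric_eq inner_commute)
  then show ?thesis
    unfolding lie_bilinear_def D_heis_metric D_a[OF x] dB_def heis_metric_eq[of x "D A x v"]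
      heis_metric_eq[of x v "D A x w"]
    using Im_herm_swap[of "snd (A x)"] by (simp add: algebra_simps)
qed

lemma hderiv_a: "x \<in> S \<Longrightarrow> hderiv u a x = 2 * Im (herm u (snd (A x))) - 2 * vderiv (b u) x"
  using killing[of x "(1, 0)" "horizontal_lift x u"] by (simp add: D_b)

lemma hderiv_b: "x \<in> S \<Longrightarrow> hderiv u (b v) x = - hderiv v (b u) x"
  using killing[of x "horizontal_lift x u" "horizontal_lift x v"] by (simp add: D_b inner_commute)

text \<open>The exterior derivative of \<open>\<eta> = a \<omega>\<^sub>0 + 2 \<langle>b, \<cdot>\<rangle>\<close>.\<close>

lemma ext_deriv_eta:
  assumes x: "x \<in> S"
  shows "ext_deriv \<eta> x v w = D a x v * heis_form x w - D a x w * heis_form x v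
    + 2 * a x * Im (herm (snd v) (snd w)) + 2 * (dB x v \<bullet> snd w) - 2 * (dB x w \<bullet> snd v)"
proof -
  have "D (\<lambda>y. \<eta> y w) x v = D a x v * heis_form x w + a x * Im (herm (snd v) (snd w)) + 2 * (dB x v \<bullet> snd w)" for v w
  proof -
    have "((\<lambda>y. a y * heis_form y w + 2 * b (snd w) y) has_derivative
        (\<lambda>h. a x * Im (herm (snd h) (snd w)) + D a x h * heis_form x w + 2 * D (b (snd w)) x h)) (at x)"
      by (intro has_derivative_add has_derivative_mult has_derivative_mult_right heis_form_has_derivative
          smooth_on_has_derivative[OF a_smooth x] smooth_on_has_derivative[OF b_smooth x])
    then have "D (\<lambda>y. a y * heis_form y w + 2 * b (snd w) y) x v =
        a x * Im (herm (snd v) (snd w)) + D a x v * heis_form x w + 2 * D (b (snd w)) x v"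
      by (rule D_eqI)
    moreover have "D (\<lambda>y. \<eta> y w) x = D (\<lambda>y. a y * heis_form y w + 2 * b (snd w) y) x"
      by (rule D_cong[OF S x eta_eq])
    ultimately show ?thesis by (simp add: D_b[OF x])
  qed
  then show ?thesis
    using Im_herm_swap[of "snd w" "snd v"] by (simp add: ext_deriv_def algebra_simps)
qed

end

section \<open>Rigidity of the Reeb field\<close>

text \<open>The matrix of the commutator form \<open>Im \<langle>u, w\<rangle>\<close> with respect to the Euclidean inner product.\<close>

definition rot :: "complex ^ 'n::finite \<Rightarrow> complex ^ 'n" where "rot w = - (\<i> *s w)"

lemma Im_herm_rot: "Im (herm u w) = u \<bullet> rot w"
  by (simp add: rot_def Re_herm[symmetric] herm_ii)

lemma rot_skew: "u \<bullet> rot w = - (w \<bullet> rot u)"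
  using Im_herm_swap[of u w] by (simp add: Im_herm_rot)

lemma rot_isometry: "rot w \<bullet> rot w = w \<bullet> w"
  by (simp add: rot_def inner_vec_def inner_complex_def add.commute)

lemma hderiv_has_D:
  assumes "open S" "x \<in> S" "smooth_on S f"
  shows "(hderiv u f has_derivative D (hderiv u f) x) (at x)"
  using differentiableI[OF hderiv_has_derivative[OF assms]] by (simp add: frechet_derivative_works)

lemma sum_Basis_square: "(\<Sum>j\<in>Basis. (v \<bullet> j)\<^sup>2) = v \<bullet> v" for v :: "'a::euclidean_space"
  by (simp add: power2_eq_square euclidean_inner[of v v])

context heis_sasaki_chart
begin

lemma norm_A_sum: "y \<in> S \<Longrightarrow> (a y)\<^sup>2 + 2 * (\<Sum>i\<in>Basis. (b i y)\<^sup>2) = 1"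
  using norm_A[of y] by (simp add: b_def sum_Basis_square)

lemma norm_A_first:
  assumes y: "y \<in> S"
  shows "a y * hderiv u a y + 2 * (\<Sum>i\<in>Basis. b i y * hderiv u (b i) y) = 0"
proof -
  have "((\<lambda>y. (a y)\<^sup>2 + 2 * (\<Sum>i\<in>Basis. (b i y)\<^sup>2)) has_derivative
      (\<lambda>h. 2 * (a y * D a y h) + 2 * (\<Sum>i\<in>Basis. 2 * (b i y * D (b i) y h)))) (at y)"
    by (auto intro!: derivative_eq_intros smooth_on_has_derivative[OF a_smooth y]
      smooth_on_has_derivative[OF b_smooth y] sum.cong simp: fun_eq_iff mult_ac)
  note D_eqI[OF this, of "horizontal_lift y u", symmetric]
  from trans[OF this fun_cong[OF D_cong[OF S y norm_A_sum]]]
  have "2 * (a y * hderiv u a y) + 2 * (\<Sum>i\<in>Basis. 2 * (b i y * hderiv u (b i) y)) =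
      D (\<lambda>y. 1) y (horizontal_lift y u)"
    by simp
  then show ?thesis by (simp add: sum_distrib_left[symmetric])
qed

lemma norm_A_second:
  assumes x: "x \<in> S"
  shows "a x * hderiv u (hderiv u a) x + (hderiv u a x)\<^sup>2 +
    2 * (\<Sum>i\<in>Basis. b i x * hderiv u (hderiv u (b i)) x + (hderiv u (b i) x)\<^sup>2) = 0"
proof -
  let ?v = "horizontal_lift x u"
  have "((\<lambda>y. a y * hderiv u a y + 2 * (\<Sum>i\<in>Basis. b i y * hderiv u (b i) y)) has_derivative
      (\<lambda>h. (a x * D (hderiv u a) x h + D a x h * hderiv u a x) +
        2 * (\<Sum>i\<in>Basis. b i x * D (hderiv u (b i)) x h + D (b i) x h * hderiv u (b i) x))) (at x)"
    by (intro has_derivative_add has_derivative_mult has_derivative_mult_right has_derivative_sum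
      smooth_on_has_derivative[OF a_smooth x] smooth_on_has_derivative[OF b_smooth x]
      hderiv_has_D[OF S x a_smooth] hderiv_has_D[OF S x b_smooth])
  note D_eqI[OF this, of ?v, symmetric]
  from trans[OF this fun_cong[OF D_cong[OF S x norm_A_first]]]
  have "(a x * D (hderiv u a) x ?v + D a x ?v * hderiv u a x) +
        2 * (\<Sum>i\<in>Basis. b i x * D (hderiv u (b i)) x ?v + D (b i) x ?v * hderiv u (b i) x) =
      D (\<lambda>y. 0) x ?v"
    by simp
  then show ?thesis by (simp add: power2_eq_square)
qed

lemma hderiv_b_self: "y \<in> S \<Longrightarrow> hderiv u (b u) y = 0"
  using hderiv_b[of y u u] by simp

text \<open>Differentiating the mixed Killing equation \<open>X\<^sub>u a = 2 \<langle>u, rot b\<rangle> - 2 T\<langle>b, u\<rangle>\<close> along \<open>X\<^sub>u\<close>, the last term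
  becomes \<open>T X\<^sub>u \<langle>b, u\<rangle>\<close> and drops out because \<open>X\<^sub>u \<langle>b, u\<rangle>\<close> vanishes identically.\<close>

lemma hderiv_hderiv_a:
  assumes x: "x \<in> S"
  shows "hderiv u (hderiv u a) x = 2 * (u \<bullet> rot (dB x (horizontal_lift x u)))"
proof -
  let ?v = "horizontal_lift x u"
  have "linear (\<lambda>w. u \<bullet> rot w)"
    by (auto intro!: linearI simp: Im_herm_rot[symmetric] herm_add_right herm_scaleR_right)
  then have bl: "bounded_linear (\<lambda>w. u \<bullet> rot w)" by (simp add: linear_conv_bounded_linear)
  have "((\<lambda>y. 2 * (u \<bullet> rot (snd (A y))) - 2 * vderiv (b u) y) has_derivative
      (\<lambda>h. 2 * (u \<bullet> rot (dB x h)) - 2 * D (vderiv (b u)) x h)) (at x)"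
    unfolding dB_def
    by (intro has_derivative_diff has_derivative_mult_right bounded_linear.has_derivative[OF bl]
      has_derivative_snd smooth_on_has_derivative[OF A_smooth x]
      smooth_on_has_derivative[OF smooth_on_D[OF b_smooth] x])
  from D_eqI[OF this, of ?v]
  have "D (\<lambda>y. 2 * (u \<bullet> rot (snd (A y))) - 2 * vderiv (b u) y) x ?v =
      2 * (u \<bullet> rot (dB x ?v)) - 2 * vderiv (hderiv u (b u)) x"
    by (simp add: hderiv_vderiv[OF S x b_smooth])
  moreover have "D (hderiv u (b u)) x = D (\<lambda>y. 0) x"
    by (rule D_cong[OF S x hderiv_b_self])
  moreover have "D (hderiv u a) x = D (\<lambda>y. 2 * (u \<bullet> rot (snd (A y))) - 2 * vderiv (b u) y) x"
    by (rule D_cong[OF S x]) (simp add: hderiv_a Im_herm_rot)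
  ultimately show ?thesis by simp
qed

text \<open>Skew symmetry turns \<open>X\<^sub>u X\<^sub>u \<langle>b, v\<rangle>\<close> into \<open>- X\<^sub>u X\<^sub>v \<langle>b, u\<rangle>\<close>; interchanging the two fields leaves only
  the commutator term, again because \<open>X\<^sub>u \<langle>b, u\<rangle> = 0\<close>.\<close>

lemma hderiv_hderiv_b:
  assumes x: "x \<in> S"
  shows "hderiv u (hderiv u (b v)) x = 2 * (u \<bullet> rot v) * (dB x (1, 0) \<bullet> u)"
proof -
  have "D (hderiv u (b v)) x = D (\<lambda>y. - hderiv v (b u) y) x"
    by (rule D_cong[OF S x hderiv_b])
  also have "\<dots> = (\<lambda>h. - D (hderiv v (b u)) x h)"
    using D_eqI[OF has_derivative_minus[OF hderiv_has_D[OF S x b_smooth]]] by blast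
  finally have "hderiv u (hderiv u (b v)) x = - hderiv u (hderiv v (b u)) x" by simp
  moreover have "D (hderiv u (b u)) x = D (\<lambda>y. 0) x"
    by (rule D_cong[OF S x hderiv_b_self])
  ultimately show ?thesis
    using hderiv_commutator[OF S x b_smooth, of u v u] by (simp add: D_b[OF x] Im_herm_rot)
qed

lemma ext_deriv_frame:
  assumes x: "x \<in> S"
  shows "ext_deriv \<eta> x (1, 0) (horizontal_lift x u) = (4 *\<^sub>R dB x (1, 0) - 2 *\<^sub>R rot (snd (A x))) \<bullet> u"
    and "ext_deriv \<eta> x (horizontal_lift x u) (horizontal_lift x v) =
      2 * a x * (u \<bullet> rot v) + 4 * hderiv u (b v) x"
  using hderiv_a[OF x, of u] hderiv_b[OF x, of v u]
  by (simp_all add: ext_deriv_eta[OF x] D_b[OF x] Im_herm_rot inner_diff_left inner_diff_right inner_commute)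

text \<open>Both sides are the squared norm of \<open>\<phi> w\<close>; on the left it is computed in the left-invariant frame.\<close>

lemma structure_norms:
  assumes x: "x \<in> S"
  shows "(ext_deriv \<eta> x (1, 0) w)\<^sup>2 + (\<Sum>j\<in>Basis. (ext_deriv \<eta> x (horizontal_lift x j) w)\<^sup>2) / 2 =
    heis_metric x w w - (\<eta> x w)\<^sup>2"
proof -
  obtain \<phi> where "\<And>v w. ext_deriv \<eta> x v w = heis_metric x v (\<phi> w)"
    "\<And>w. heis_metric x (\<phi> w) (\<phi> w) = heis_metric x w w - (\<eta> x w)\<^sup>2"
    using sasaki_structure_tensor[OF S x ph reeb, of heis_metric] metric[OF x] by metis
  then show ?thesis using heis_metric_frame[of x "\<phi> w"] by simp
qed

text \<open>The three equations are the horizontal Laplacian of \<open>a\<^sup>2 + 2|b|\<^sup>2 = 1\<close>, the norm of \<open>\<phi> T\<close>, and the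
  sum of the squared norms of \<open>\<phi> X\<^sub>i\<close>. Beside \<open>|b|\<^sup>2\<close> they involve \<open>|\<tau>|\<^sup>2 - \<langle>\<tau>, rot b\<rangle>\<close> and
  \<open>a \<langle>H, c\<rangle> + |H|\<^sup>2\<close>, where \<open>\<tau> = T b\<close> and \<open>c\<close> is the commutator form; eliminating these two quantities
  leaves a positive multiple of \<open>|b|\<^sup>2\<close>.\<close>

lemma snd_A_zero:
  assumes x: "x \<in> S"
  shows "snd (A x) = 0"
proof -
  define U where "U = snd (A x)"
  define \<tau> where "\<tau> = dB x (1, 0)"
  define H where "H j i = hderiv j (b i) x" for j i
  define c where "c j i = j \<bullet> rot i" for j i :: "complex ^ 'n"
  define N where "N = real DIM(complex ^ 'n)"
  let ?B = "Basis :: (complex ^ 'n) set"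
  define HC where "HC = (\<Sum>j\<in>?B. \<Sum>i\<in>?B. H j i * c j i)"
  define HH where "HH = (\<Sum>j\<in>?B. \<Sum>i\<in>?B. (H j i)\<^sup>2)"
  \<comment> \<open>The entries of \<open>c\<close> are those of the skew matrix of \<open>rot\<close>.\<close>
  have expand: "j \<bullet> rot w = (\<Sum>i\<in>?B. (w \<bullet> i) * c j i)" for j w
    using rot_skew[of j] euclidean_inner[of w "rot j"]
    by (simp add: c_def sum_negf inner_commute)
  have norm: "(a x)\<^sup>2 = 1 - 2 * (U \<bullet> U)"
    using norm_A[OF x] by (simp add: U_def)

  \<comment> \<open>The horizontal Laplacian of \<open>a\<^sup>2 + 2|b|\<^sup>2\<close>, divided by 2.\<close>
  have eq1: "4 * (U \<bullet> U) - 4 * (\<tau> \<bullet> rot U) + 4 * (\<tau> \<bullet> \<tau>) + 2 * (a x * HC) + 2 * HH = 0"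
  proof -
    have j: "a x * (2 * (\<Sum>i\<in>?B. H j i * c j i)) + 4 * ((rot U - \<tau>) \<bullet> j)\<^sup>2 +
        4 * ((\<tau> \<bullet> j) * (rot U \<bullet> j)) + 2 * (\<Sum>i\<in>?B. (H j i)\<^sup>2) = 0" for j
    proof -
      have "hderiv j a x = 2 * ((rot U - \<tau>) \<bullet> j)"
        by (simp add: hderiv_a[OF x] D_b[OF x] Im_herm_rot U_def \<tau>_def inner_diff_left inner_diff_right inner_commute)
      moreover have "hderiv j (hderiv j a) x = 2 * (\<Sum>i\<in>?B. H j i * c j i)"
        by (simp add: hderiv_hderiv_a[OF x] expand H_def D_b[OF x])
      moreover have "(\<Sum>i\<in>?B. b i x * hderiv j (hderiv j (b i)) x) = 2 * ((\<tau> \<bullet> j) * (rot U \<bullet> j))"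
      proof -
        have "(\<Sum>i\<in>?B. b i x * hderiv j (hderiv j (b i)) x) = (\<Sum>i\<in>?B. 2 * (\<tau> \<bullet> j) * ((U \<bullet> i) * c j i))"
          by (simp add: hderiv_hderiv_b[OF x] b_def U_def \<tau>_def c_def mult_ac)
        also have "\<dots> = 2 * (\<tau> \<bullet> j) * (j \<bullet> rot U)"
          by (simp add: expand sum_distrib_left)
        finally show ?thesis by (simp add: inner_commute)
      qed
      ultimately show ?thesis
        using norm_A_second[OF x, of j]
        by (simp add: sum.distrib H_def[symmetric] power_mult_distrib)
    qed
    have "(\<Sum>j\<in>?B. a x * (2 * (\<Sum>i\<in>?B. H j i * c j i)) + 4 * ((rot U - \<tau>) \<bullet> j)\<^sup>2 +
        4 * ((\<tau> \<bullet> j) * (rot U \<bullet> j)) + 2 * (\<Sum>i\<in>?B. (H j i)\<^sup>2)) = 0"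
      by (simp only: j sum.neutral_const)
    then have "a x * (2 * HC) + 4 * ((rot U - \<tau>) \<bullet> (rot U - \<tau>)) + 4 * (\<tau> \<bullet> rot U) + 2 * HH = 0"
      by (simp add: sum.distrib sum_distrib_left[symmetric] HC_def HH_def sum_Basis_square
          euclidean_inner[of \<tau> "rot U"])
    then show ?thesis
      by (simp add: inner_diff_left inner_diff_right rot_isometry inner_commute algebra_simps)
  qed

  define K where "K = 4 *\<^sub>R \<tau> - 2 *\<^sub>R rot U"
  have KK: "K \<bullet> K = 16 * (\<tau> \<bullet> \<tau>) - 16 * (\<tau> \<bullet> rot U) + 4 * (U \<bullet> U)"
    by (simp add: K_def inner_diff_left inner_diff_right rot_isometry inner_commute)
  have MK: "ext_deriv \<eta> x (1, 0) (horizontal_lift x j) = K \<bullet> j" for j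
    by (simp add: ext_deriv_frame[OF x] K_def \<tau>_def U_def)

  \<comment> \<open>The norm of \<open>\<phi> T\<close>; here \<open>K\<close> collects the mixed coefficients of \<open>d\<eta>\<close>.\<close>
  have eq2: "K \<bullet> K = 4 * (U \<bullet> U)"
  proof -
    have "ext_deriv \<eta> x (horizontal_lift x j) (1, 0) = - (K \<bullet> j)" for j
      using MK ext_deriv_swap[of \<eta> x] by metis
    moreover have "ext_deriv \<eta> x (1, 0) (1, 0) = 0"
      using ext_deriv_swap[of \<eta> x "(1, 0)" "(1, 0)"] by simp
    ultimately show ?thesis
      using structure_norms[OF x, of "(1, 0)"] norm
      by (simp add: sum_Basis_square eta_eq[OF x] b_def heis_metric_eq)
  qed

  \<comment> \<open>The squared norms of \<open>\<phi> X\<^sub>i\<close>, summed over \<open>i\<close>.\<close>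
  have eq3: "K \<bullet> K + (2 * ((a x)\<^sup>2 * N) + 8 * (a x * HC) + 8 * HH) = 2 * N - 4 * (U \<bullet> U)"
  proof -
    have i: "(K \<bullet> i)\<^sup>2 + (\<Sum>j\<in>?B. 2 * ((a x)\<^sup>2 * (c j i)\<^sup>2) + 8 * (a x * (H j i * c j i)) + 8 * (H j i)\<^sup>2)
        = 2 - 4 * (U \<bullet> i)\<^sup>2" if "i \<in> ?B" for i
    proof -
      have "(\<Sum>j\<in>?B. (ext_deriv \<eta> x (horizontal_lift x j) (horizontal_lift x i))\<^sup>2) / 2 =
          (\<Sum>j\<in>?B. 2 * ((a x)\<^sup>2 * (c j i)\<^sup>2) + 8 * (a x * (H j i * c j i)) + 8 * (H j i)\<^sup>2)"
        unfolding sum_divide_distrib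
        by (rule sum.cong) (simp_all add: ext_deriv_frame[OF x] c_def H_def power2_eq_square algebra_simps)
      then show ?thesis
        using structure_norms[OF x, of "horizontal_lift x i"] that
        by (simp add: MK eta_eq[OF x] b_def U_def heis_metric_eq power_mult_distrib)
    qed
    have "(\<Sum>j\<in>?B. (c j i)\<^sup>2) = 1" if "i \<in> ?B" for i
    proof -
      have "c j i = rot i \<bullet> j" for j by (simp add: c_def inner_commute)
      then show ?thesis using that by (simp add: sum_Basis_square rot_isometry)
    qed
    then have CC: "(\<Sum>i\<in>?B. \<Sum>j\<in>?B. (c j i)\<^sup>2) = N" by (simp add: N_def)
    have "(\<Sum>i\<in>?B. (K \<bullet> i)\<^sup>2 + (\<Sum>j\<in>?B. 2 * ((a x)\<^sup>2 * (c j i)\<^sup>2) + 8 * (a x * (H j i * c j i)) + 8 * (H j i)\<^sup>2))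
        = (\<Sum>i\<in>?B. 2 - 4 * (U \<bullet> i)\<^sup>2)"
      by (rule sum.cong[OF refl i])
    moreover have "HC = (\<Sum>i\<in>?B. \<Sum>j\<in>?B. H j i * c j i)" "HH = (\<Sum>i\<in>?B. \<Sum>j\<in>?B. (H j i)\<^sup>2)"
      unfolding HC_def HH_def by (rule sum.swap)+
    ultimately show ?thesis
      by (simp add: sum.distrib sum_subtractf sum_distrib_left[symmetric] sum_Basis_square CC N_def)
  qed
  have "(N + 2) * (U \<bullet> U) = 0"
    using eq1 eq2 eq3 unfolding KK norm by (simp add: algebra_simps)
  then have "U \<bullet> U = 0" by (simp add: N_def add_nonneg_eq_0_iff)
  then show ?thesis by (simp add: U_def)
qed

theorem reeb_vertical: "x \<in> S \<Longrightarrow> (heis_form x (A x))\<^sup>2 = 1"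
  using norm_A[of x] snd_A_zero[of x] by (simp add: a_def)

end

section \<open>The Reeb field of the quotient, lifted to the Heisenberg group\<close>

definition small_chart :: "'n::finite \<Rightarrow> 'n heis \<Rightarrow> ('n heis set, 'n heis) chart" where
  "small_chart k x = (orbit (infra_group k) ` ball x (1/4), inv_into (ball x (1/4)) (orbit (infra_group k)))"

text \<open>A non-trivial element of the group moves every point by at least 1/2, the diameter of the ball.\<close>

lemma inj_on_small_ball: "inj_on (orbit (infra_group k)) (ball x (1/4))"
proof (rule inj_onI)
  fix y z assume yz: "y \<in> ball x (1/4)" "z \<in> ball x (1/4)"
    and "orbit (infra_group k) y = orbit (infra_group k) z"
  then obtain g where g: "g \<in> infra_group k" "z = g y"
    using orbit_eq[OF transformation_group_infra] by blast
  have "dist z y < 1/2"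
    using yz dist_triangle_half_r[of x z "1/2" y] by (simp add: mem_ball)
  then show "y = z" using infra_group_separated[OF g(1), of y] g(2) by simp
qed

lemma small_chart_in_atlas: "small_chart k x \<in> quotient_atlas (infra_group k)"
  unfolding small_chart_def quotient_atlas_def using inj_on_small_ball[of k x] by blast

lemma small_chart_range: "chart_range (small_chart k x) = ball x (1/4)"
  unfolding small_chart_def by (rule quotient_chart_range[OF inj_on_small_ball])

text \<open>The isometry \<open>g\<close> of the covering is the change between two charts around points that it relates.
  For \<open>g = id\<close> this compares overlapping charts, for \<open>g = \<mu>\<close> it expresses invariance under \<open>\<mu>\<close>.\<close>

lemma small_chart_transition:
  assumes g: "g \<in> infra_group k" "(g has_derivative g') (at z)"
    and z: "z \<in> ball x (1/4)" "g z \<in> ball y (1/4)"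
  shows "z \<in> overlap (small_chart k x) (small_chart k y)"
    and "chart_change (small_chart k x) (small_chart k y) z = g z"
    and "transition_deriv (small_chart k x) (small_chart k y) z = g'"
proof -
  let ?o = "orbit (infra_group k)"
  define W where "W = ball x (1/4) \<inter> g -` ball y (1/4)"
  have orb: "?o w = ?o (g w)" for w
    using orbit_eq[OF transformation_group_infra] g(1) by blast
  then show "z \<in> overlap (small_chart k x) (small_chart k y)"
    unfolding small_chart_def overlap_quotient[OF inj_on_small_ball] using z by blast
  have ch: "chart_change (small_chart k x) (small_chart k y) w = g w" if "w \<in> W" for w
    unfolding small_chart_def
    by (rule chart_change_quotient[OF inj_on_small_ball inj_on_small_ball _ _ orb]) (use that in \<open>auto simp: W_def\<close>)
  have zW: "z \<in> W" using z by (simp add: W_def)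
  then show "chart_change (small_chart k x) (small_chart k y) z = g z" by (rule ch)
  have "continuous_on UNIV g" by (rule smooth_on_continuous[OF infra_group_smooth[OF g(1)]])
  then have "open W"
    unfolding W_def by (intro open_Int open_ball open_vimage)
  then show "transition_deriv (small_chart k x) (small_chart k y) z = g'"
    by (rule frechet_derivative_cong_open[OF _ zW _ g(2)]) (simp add: ch)
qed

lemma id_in_infra_group: "id \<in> infra_group k"
  using transformation_group_infra[of k] by (simp add: transformation_group_def)

lemma heis_mu_in_infra_group: "heis_mu k \<in> infra_group k"
  unfolding infra_group_def by (rule generate.incl) simp

lemma heis_mu_reverses_form:
  fixes k :: "'n::finite"
  shows "\<exists>L. (\<forall>x. (heis_mu k has_derivative L) (at x)) \<and>
    (\<forall>x v. heis_form (heis_mu k x) (L v) = - heis_form x v)"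
proof (intro exI conjI allI)
  let ?L = "\<lambda>v :: 'n heis. (- fst v + Im (snd v $ k) / 2, \<chi> i. cnj (snd v $ i))"
  have "linear ?L"
    by (auto intro!: linearI simp: vec_eq_iff add_divide_distrib algebra_simps)
  moreover have "heis_mu k = (\<lambda>x. ?L x + (0, axis k (1/2)))"
    by (auto simp: fun_eq_iff heis_mu_eq)
  ultimately show "(heis_mu k has_derivative ?L) (at x)" for x
    by (rule infra_group_has_derivative)
  show "heis_form (heis_mu k x) (?L v) = - heis_form x v" for x v
    by (cases x, cases v) (simp add: heis_mu_eq heis_form_def herm_add_left herm_axis herm_cnj)
qed

theorem lemma8p4:
  fixes k :: "'n::finite"
  shows "\<not> (\<exists>\<eta> J. compatible_sasaki (quotient_atlas (infra_group k)) (quotient_metric heis_metric) \<eta> J)"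
proof
  assume "\<exists>\<eta> J. compatible_sasaki (quotient_atlas (infra_group k)) (quotient_metric heis_metric) \<eta> J"
  then obtain \<eta> J A where sasaki: "pseudo_hermitian (quotient_atlas (infra_group k)) \<eta> J"
    "reeb_field (quotient_atlas (infra_group k)) \<eta> A"
    "\<forall>c\<in>quotient_atlas (infra_group k). flow_preserves_on (chart_range c) (A c) (\<eta> c) (J c)"
    "\<forall>c\<in>quotient_atlas (infra_group k). \<forall>x\<in>chart_range c. \<forall>v w.
       quotient_metric heis_metric c x v w = sasaki_metric (\<eta> c) (J c) (A c) x v w"
    unfolding compatible_sasaki_def by blast
  let ?c = "small_chart k"
  have chart: "heis_sasaki_chart (ball x (1/4)) (\<eta> (?c x)) (J (?c x)) (A (?c x))" for x
    using sasaki small_chart_in_atlas[of k x] small_chart_range[of k x]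
    by unfold_locales (auto simp: pseudo_hermitian_def reeb_field_def quotient_metric_def)
  have vec: "transition_deriv (?c x) (?c y) z (A (?c x) z) = A (?c y) (chart_change (?c x) (?c y) z)"
    if "z \<in> overlap (?c x) (?c y)" for x y z
    using sasaki(2) small_chart_in_atlas that unfolding reeb_field_def vector_field_def by blast
  \<comment> \<open>The vertical component of the Reeb field, lifted to the Heisenberg group.\<close>
  define f where "f x = heis_form x (A (?c x) x)" for x
  \<comment> \<open>The chart centred at \<open>y\<close> may be replaced by any small chart around \<open>y\<close>, so that \<open>f\<close> is continuous.\<close>
  have f_chart: "f y = heis_form y (A (?c x) y)" if "y \<in> ball x (1/4)" for x y
    using vec[of y x y] small_chart_transition[of id k id y x y, OF id_in_infra_group] that
    by (simp add: f_def has_derivative_id)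
  have f1: "(f x)\<^sup>2 = 1" for x
    unfolding f_def by (rule heis_sasaki_chart.reeb_vertical[OF chart]) simp
  have "isCont f x" for x
  proof -
    have "continuous_on (ball x (1/4)) (\<lambda>y. heis_form y (A (?c x) y))"
      using smooth_on_continuous[OF heis_sasaki_chart.a_smooth[OF chart[of x]]]
      by (simp add: heis_sasaki_chart.a_def[OF chart])
    then have "continuous_on (ball x (1/4)) f"
      by (rule continuous_on_eq) (simp add: f_chart)
    then show ?thesis by (simp add: continuous_on_eq_continuous_at)
  qed
  then have cont: "continuous_on UNIV f" by (simp add: continuous_at_imp_continuous_on)
  obtain L where L: "\<And>x. (heis_mu k has_derivative L) (at x)"
    "\<And>x v. heis_form (heis_mu k x) (L v) = - heis_form x v"
    using heis_mu_reverses_form[of k] by blast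
  have f_mu: "f (heis_mu k x) = - f x" for x
    using vec[of x x "heis_mu k x"]
      small_chart_transition[OF heis_mu_in_infra_group L(1), of x x "heis_mu k x"]
      L(2)[of x "A (?c x) x"]
    by (simp add: f_def)
  have "connected (range f)"
    by (rule connected_continuous_image[OF cont connected_UNIV])
  moreover have "f 0 \<in> range f" "- f 0 \<in> range f"
    unfolding f_mu[symmetric] by (rule rangeI)+
  ultimately have "0 \<in> range f"
    using connectedD_interval[of "range f" "f 0" "- f 0" 0] connectedD_interval[of "range f" "- f 0" "f 0" 0]
    by (cases "f 0 \<le> 0") auto
  then obtain x where "f x = 0" by (metis rangeE)
  then show False using f1[of x] by simp
qed

end
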